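(* Let $K$ be an algebraically closed field of characteristic $p\ne 5$ (with $p=0$ allowed). Then for a general rational curve $C\subset\mathbb{P}^4_K$ of degree $5$, there is a quartic threefold $X\subset\mathbb{P}^4_K$ containing $C$ such that the normal bundle $N_{C/X}$ is balanced.
   Context: A general rational curve of degree $5$ in $\mathbb{P}^4$ is the image of a general morphism $\mathbb{P}^1\to\mathbb{P}^4$ given by five forms of degree $5$ (it is smooth, $C\cong\mathbb{P}^1$). A quartic threefold is a hypersurface of degree $4$ in $\mathbb{P}^4$; here $X$ is smooth along $C$, so that $N_{C/X}$ is a vector bundle of rank $2$ on $C\cong\mathbb{P}^1$. A vector bundle $\bigoplus_i\mathcal{O}_{\mathbb{P}^1}(a_i)$ on $\mathbb{P}^1$ is balanced if $|a_i-a_j|\le 1$ for all $i,j$. *)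

theory Defs
  imports
    "HOL-Library.Poly_Mapping"
    "HOL-Library.Numeral_Type"
    "HOL-Computational_Algebra.Computational_Algebra"
    "HOL-Analysis.Finite_Cartesian_Product"
    "HOL-Analysis.Cartesian_Space"
begin

section \<open>Multivariate polynomials\<close>

text \<open>
  A polynomial in the variables \<open>'v\<close> is an element of the ring \<open>('v \<Rightarrow>\<^sub>0 nat) \<Rightarrow>\<^sub>0 'a\<close>.
  The argument \<open>h\<close> of the evaluation maps the coefficients into the ring in which
  the variables take their values.
\<close>

type_synonym ('v, 'a) mpoly = "('v \<Rightarrow>\<^sub>0 nat) \<Rightarrow>\<^sub>0 'a"

definition mpoly_eval ::
    "('a::comm_ring_1 \<Rightarrow> 'b::comm_ring_1) \<Rightarrow> ('v, 'a) mpoly \<Rightarrow> ('v \<Rightarrow> 'b) \<Rightarrow> 'b" where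
  "mpoly_eval h P x =
     (\<Sum>m\<in>Poly_Mapping.keys P. h (Poly_Mapping.lookup P m) *
        (\<Prod>i\<in>Poly_Mapping.keys m. x i ^ Poly_Mapping.lookup m i))"

definition mpoly_pderiv :: "'v \<Rightarrow> ('v, 'a::comm_ring_1) mpoly \<Rightarrow> ('v, 'a) mpoly" where
  "mpoly_pderiv i P =
     (\<Sum>m\<in>Poly_Mapping.keys P. Poly_Mapping.single (m - Poly_Mapping.single i 1)
        (of_nat (Poly_Mapping.lookup m i) * Poly_Mapping.lookup P m))"

definition homogeneous :: "nat \<Rightarrow> ('v::finite, 'a::comm_ring_1) mpoly \<Rightarrow> bool" where
  "homogeneous d P \<longleftrightarrow>
     (\<forall>m\<in>Poly_Mapping.keys P. (\<Sum>i\<in>UNIV. Poly_Mapping.lookup m i) = d)"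


section \<open>Vector bundles on the projective line\<close>

text \<open>
  The line has homogeneous coordinates \<open>[s : t]\<close> and is covered by two charts,
  chart 0 (\<open>s \<noteq> 0\<close>) with coordinate \<open>t/s\<close> and chart 1 (\<open>t \<noteq> 0\<close>) with coordinate
  \<open>s/t\<close>. On either chart a section of \<open>\<O>(d)\<^sup>n\<close> is a vector of \<open>n\<close> polynomials in the chart
  coordinate, the trivialisations of \<open>\<O>(d)\<close> being by \<open>s\<^sup>d\<close> and \<open>t\<^sup>d\<close>.

  The following record describes a quotient \<open>A/B\<close> of two quasi-coherent subsheaves
  \<open>B \<subseteq> A \<subseteq> \<O>(d)\<^sup>n\<close> by the modules of sections of \<open>A\<close> (\<open>num\<close>) and \<open>B\<close> (\<open>den\<close>)
  over chart 0 and chart 1.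
\<close>

record (overloaded) ('a, 'n) subquotient =
  twist :: nat
  num0 :: "('a poly ^ 'n) set"
  den0 :: "('a poly ^ 'n) set"
  num1 :: "('a poly ^ 'n) set"
  den1 :: "('a poly ^ 'n) set"

text \<open>The classes of \<open>v\<^sub>0, \<dots>, v\<^sub>r\<^sub>-\<^sub>1\<close> form a basis of the module \<open>A/B\<close>.\<close>

definition quotient_basis ::
    "('a::field poly ^ 'n) set \<Rightarrow> ('a poly ^ 'n) set \<Rightarrow> ('a poly ^ 'n) list \<Rightarrow> bool" where
  "quotient_basis A B vs \<longleftrightarrow>
     set vs \<subseteq> A \<and>
     (\<forall>x\<in>A. \<exists>!cs. length cs = length vs \<and> x - (\<Sum>j<length vs. cs ! j *s vs ! j) \<in> B)"

text \<open>
  Sections over the overlap of the charts are compared inside \<open>K(t)\<^sup>n\<close>, in the trivialisation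
  of chart 0: there a section \<open>w(u)\<close> of \<open>\<O>(d)\<^sup>n\<close> over chart 1 reads \<open>t\<^sup>d w(1/t)\<close>.
\<close>

definition rat_var :: "'a::field poly fract" where
  "rat_var = to_fract [:0, 1:]"

definition from_chart0 :: "'a::field poly ^ 'n \<Rightarrow> 'a poly fract ^ 'n" where
  "from_chart0 v = (\<chi> i. to_fract (v $ i))"

definition from_chart1 :: "nat \<Rightarrow> 'a::field poly ^ 'n \<Rightarrow> 'a poly fract ^ 'n" where
  "from_chart1 d w =
     (\<chi> i. rat_var ^ d * poly (map_poly (\<lambda>c. to_fract [:c:]) (w $ i)) (inverse rat_var))"

text \<open>The localisation \<open>B[1/t]\<close>.\<close>

definition on_overlap :: "('a::field poly ^ 'n) set \<Rightarrow> ('a poly fract ^ 'n) set" where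
  "on_overlap B = {x. \<exists>k. \<exists>b\<in>B. rat_var ^ k *s x = from_chart0 b}"

text \<open>
  \<open>A/B\<close> is isomorphic to \<open>\<Oplus>\<^sub>j \<O>(a\<^sub>j)\<close>: an isomorphism is given by the images \<open>v\<^sub>j\<close>
  and \<open>w\<^sub>j\<close> of the generators \<open>s\<^bsup>a\<^sub>j\<^esup>\<close> and \<open>t\<^bsup>a\<^sub>j\<^esup>\<close> of \<open>\<O>(a\<^sub>j)\<close> over chart 0 and
  chart 1, which have to be bases and to satisfy \<open>w\<^sub>j = (t/s)\<^bsup>a\<^sub>j\<^esup> v\<^sub>j\<close> in \<open>A/B\<close> on the overlap.
\<close>

definition iso_sum_of_line_bundles :: "('a::field, 'n::finite) subquotient \<Rightarrow> int list \<Rightarrow> bool" where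
  "iso_sum_of_line_bundles E as \<longleftrightarrow>
     (\<exists>vs ws. length vs = length as \<and> length ws = length as \<and>
        quotient_basis (num0 E) (den0 E) vs \<and>
        quotient_basis (num1 E) (den1 E) ws \<and>
        (\<forall>j<length as.
           from_chart1 (twist E) (ws ! j) - (rat_var powi (as ! j)) *s from_chart0 (vs ! j)
             \<in> on_overlap (den0 E)))"

definition balanced :: "('a::field, 'n::finite) subquotient \<Rightarrow> bool" where
  "balanced E \<longleftrightarrow>
     (\<exists>as. iso_sum_of_line_bundles E as \<and> (\<forall>a\<in>set as. \<forall>b\<in>set as. \<bar>a - b\<bar> \<le> 1))"


section \<open>Rational quintic curves in projective 4-space\<close>

text \<open>
  A binary form \<open>\<Sum>\<^sub>j c\<^sub>j s\<^bsup>5-j\<^esup> t\<^sup>j\<close> is encoded by its coefficients, as the polynomial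
  \<open>\<Sum>\<^sub>j c\<^sub>j t\<^sup>j\<close> of degree at most 5, which is also its expression on chart 0.
\<close>

definition quintic_tuples :: "('a::field poly ^ 5) set" where
  "quintic_tuples = {f. \<forall>i. degree (f $ i) \<le> 5}"

definition curve_point :: "'a::field poly ^ 5 \<Rightarrow> 'a \<Rightarrow> 'a \<Rightarrow> 'a ^ 5" where
  "curve_point f s t = (\<chi> i. \<Sum>j\<le>5. coeff (f $ i) j * s ^ (5 - j) * t ^ j)"

text \<open>The expression \<open>\<Sum>\<^sub>j c\<^sub>j u\<^bsup>5-j\<^esup>\<close> on chart 1.\<close>

definition chart1 :: "'a::field poly ^ 5 \<Rightarrow> 'a poly ^ 5" where
  "chart1 f = (\<chi> i. \<Sum>j\<le>5. monom (coeff (f $ i) j) (5 - j))"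

definition pderiv_vec :: "'a::field poly ^ 5 \<Rightarrow> 'a poly ^ 5" where
  "pderiv_vec g = (\<chi> i. pderiv (g $ i))"

definition poly_vec :: "'a::field poly ^ 5 \<Rightarrow> 'a \<Rightarrow> 'a ^ 5" where
  "poly_vec g a = (\<chi> i. poly (g $ i) a)"

text \<open>
  If \<open>g\<close> lifts a map to projective space to homogeneous coordinates, its differential at \<open>a\<close>
  is the class of \<open>g'(a)\<close> modulo \<open>g(a)\<close>.
\<close>

definition immersive :: "'a::field poly ^ 5 \<Rightarrow> bool" where
  "immersive g \<longleftrightarrow>
     (\<forall>a \<alpha> \<beta>. \<alpha> *s poly_vec g a + \<beta> *s poly_vec (pderiv_vec g) a = 0 \<longrightarrow> \<alpha> = 0 \<and> \<beta> = 0)"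

text \<open>
  The forms define a morphism which is a closed embedding, i.e. injective with nowhere vanishing
  differential; the image is then a smooth rational curve of degree 5.
\<close>

definition smooth_rational_quintic :: "'a::field poly ^ 5 \<Rightarrow> bool" where
  "smooth_rational_quintic f \<longleftrightarrow>
     f \<in> quintic_tuples \<and>
     (\<forall>s t. (s, t) \<noteq> (0, 0) \<longrightarrow> curve_point f s t \<noteq> 0) \<and>
     (\<forall>s t s' t'. (s, t) \<noteq> (0, 0) \<longrightarrow> (s', t') \<noteq> (0, 0) \<longrightarrow>
        (\<exists>c. curve_point f s' t' = c *s curve_point f s t) \<longrightarrow> s * t' = s' * t) \<and>
     immersive f \<and> immersive (chart1 f)"

text \<open>
  Zariski open subsets of the affine space of 5-tuples of quintic forms, whose coordinates are
  the coefficients \<open>(i, j) \<mapsto> coeff (f $ i) j\<close> with \<open>j \<le> 5\<close>.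
  A property holds for a general rational quintic if it holds on a nonempty such subset all of
  whose members are closed embeddings.
\<close>

definition zariski_open :: "('a::field poly ^ 5) set \<Rightarrow> bool" where
  "zariski_open U \<longleftrightarrow>
     (\<exists>S :: (5 \<times> nat, 'a) mpoly set.
        U = {f \<in> quintic_tuples. \<exists>P\<in>S. mpoly_eval id P (\<lambda>(i, j). coeff (f $ i) j) \<noteq> 0})"

definition for_general_rational_quintic :: "('a::field poly ^ 5 \<Rightarrow> bool) \<Rightarrow> bool" where
  "for_general_rational_quintic Q \<longleftrightarrow>
     (\<exists>U. zariski_open U \<and> U \<noteq> {} \<and> (\<forall>f\<in>U. smooth_rational_quintic f \<and> Q f))"


section \<open>Quartic threefolds and the normal bundle\<close>

definition quartic_form :: "(5, 'a::field) mpoly \<Rightarrow> bool" where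
  "quartic_form F \<longleftrightarrow> F \<noteq> 0 \<and> homogeneous 4 F"

definition hypersurface_contains :: "(5, 'a::field) mpoly \<Rightarrow> 'a poly ^ 5 \<Rightarrow> bool" where
  "hypersurface_contains F f \<longleftrightarrow>
     (\<forall>s t. (s, t) \<noteq> (0, 0) \<longrightarrow> mpoly_eval id F (($) (curve_point f s t)) = 0)"

definition smooth_along :: "(5, 'a::field) mpoly \<Rightarrow> 'a poly ^ 5 \<Rightarrow> bool" where
  "smooth_along F f \<longleftrightarrow>
     (\<forall>s t. (s, t) \<noteq> (0, 0) \<longrightarrow>
        (\<exists>i. mpoly_eval id (mpoly_pderiv i F) (($) (curve_point f s t)) \<noteq> 0))"

text \<open>
  Let \<open>g\<close> be the expression of \<open>f\<close> on a chart \<open>U\<close> with coordinate ring \<open>R = K[u]\<close>, and \<open>X\<close> the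
  zero locus of \<open>F\<close>, containing the curve \<open>C\<close> and smooth along it. By the Euler sequence
  \<open>0 \<rightarrow> \<O> \<rightarrow> \<O>(1)\<^sup>5 \<rightarrow> T\<^sub>\<P> \<rightarrow> 0\<close>, the pullback of the tangent bundle of projective space is
  \<open>R\<^sup>5/R g\<close>; that of \<open>T\<^sub>X\<close> is the kernel \<open>{v. dF(g) v = 0}/R g\<close> of \<open>dF\<close>, and \<open>d/du\<close> is mapped
  to the class of \<open>g'\<close>. Hence
  \<open>N\<^bsub>C/X\<^esub> = T\<^sub>X|\<^sub>C / T\<^sub>C\<close> has sections \<open>{v. dF(g) v = 0}/(R g + R g')\<close> over \<open>U\<close>,
  and globally is a subquotient of \<open>\<O>(5)\<^sup>5 = f\<^sup>* \<O>(1)\<^sup>5\<close>.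
\<close>

definition kernel_dF :: "(5, 'a::field) mpoly \<Rightarrow> 'a poly ^ 5 \<Rightarrow> ('a poly ^ 5) set" where
  "kernel_dF F g =
     {v. (\<Sum>i\<in>UNIV. mpoly_eval (\<lambda>c. [:c:]) (mpoly_pderiv i F) (($) g) * v $ i) = 0}"

definition cone_tangent :: "'a::field poly ^ 5 \<Rightarrow> ('a poly ^ 5) set" where
  "cone_tangent g = {\<alpha> *s g + \<beta> *s pderiv_vec g | \<alpha> \<beta>. True}"

definition normal_bundle :: "(5, 'a::field) mpoly \<Rightarrow> 'a poly ^ 5 \<Rightarrow> ('a, 5) subquotient" where
  "normal_bundle F f =
     \<lparr> twist = 5,
       num0 = kernel_dF F f, den0 = cone_tangent f,
       num1 = kernel_dF F (chart1 f), den1 = cone_tangent (chart1 f) \<rparr>"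

end

theory Submission
  imports Defs "HOL-Analysis.Determinants"
begin

text \<open>
  Let \<open>F\<close> be a quartic through the curve and \<open>G\<^sub>i\<close> the form of degree 15 obtained by restricting the
  \<open>i\<close>-th partial derivative of \<open>F\<close> to it. Then \<open>N\<^bsub>C/X\<^esub> = K/T\<close>, where \<open>K\<close> is the kernel of
  \<open>G : \<O>(5)\<^sup>5 \<rightarrow> \<O>(20)\<close> and \<open>T\<close> is spanned by the two partial derivatives of \<open>f\<close>; as \<open>5 \<noteq> 0\<close>, Euler's
  relation recovers \<open>f\<close> from them, so that \<open>T \<cong> \<O>(1)\<^sup>2\<close>. The quotient has rank 2 and degree 3, hence it
  is balanced iff \<open>H\<^sup>1(N(-2)) = 0\<close>, and since \<open>T(-2) = \<O>(-1)\<^sup>2\<close> has no cohomology this says that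
  \<open>H\<^sup>1(K(-2)) = 0\<close>: \<^emph>\<open>the cubic multiples of the \<open>G\<^sub>i\<close> span all forms of degree 18\<close>. The same condition
  makes \<open>X\<close> smooth along the curve.

  The splitting is made explicit without cohomology. Under the spanning condition the relations
  \<open>\<Sum> G\<^sub>i v\<^sub>i = 0\<close> with \<open>v\<close> of degree 3 form a space of dimension \<open>20 - 19 = 1\<close>, those of degree 4 one of
  dimension \<open>25 - 20 = 5\<close>, and the relations of degree 4 generate all those of higher degree, as in
  Castelnuovo-Mumford regularity (\<open>relations_split\<close>). Besides the two multiples of the
  generator \<open>y\<close> of degree 3 and the two partial derivatives of \<open>f\<close>, which are independent as the curve is immersed,
  there is one more relation \<open>e\<close> of degree 4; the classes of \<open>y\<close> and \<open>e\<close> are bases of \<open>N\<^bsub>C/X\<^esub>\<close> over both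
  charts and exhibit it as \<open>\<O>(2) \<oplus> \<O>(1)\<close> (\<open>balanced_subquotient\<close>).

  It remains to find a quartic with the spanning condition for general \<open>f\<close>. The condition is open, so
  one pair \<open>(f\<^sub>0, F\<^sub>0)\<close> is enough if \<open>F\<^sub>0\<close> can be deformed along with \<open>f\<^sub>0\<close>. For this
  \<open>f\<^sub>0 = (1, t, t\<^sup>2, t\<^sup>4, t\<^sup>5)\<close> is convenient: every \<open>t\<^sup>k\<close> with \<open>k \<le> 20\<close> is the value of a quartic monomial
  at \<open>f\<^sub>0\<close>, so for \<open>f\<close> near \<open>f\<^sub>0\<close> Cramer's rule (\<open>open_basis_criterion\<close>) corrects a multiple of
  \<open>F\<^sub>0\<close> by these monomials to a quartic through the curve of \<open>f\<close>, with coefficients polynomial in those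
  of \<open>f\<close>. With the variables named \<open>x\<^sub>0, x\<^sub>1, x\<^sub>2, x\<^sub>4, x\<^sub>5\<close> after the exponents, the choice is
  \<open>F\<^sub>0 = x\<^sub>4\<^sup>3 x\<^sub>5 - x\<^sub>2 x\<^sub>5\<^sup>3 + x\<^sub>1 x\<^sub>2\<^sup>2 x\<^sub>5 - x\<^sub>1\<^sup>2 x\<^sub>4\<^sup>2 + x\<^sub>0\<^sup>3 x\<^sub>2 - x\<^sub>0\<^sup>2 x\<^sub>1\<^sup>2\<close>, for which the spanning condition comes
  down to the invertibility of 5 (\<open>spanning_set_monomials\<close>). The same use of Cramer's rule shows that the general \<open>f\<close> is a closed
  embedding (\<open>general_quintic_smooth\<close>).
\<close>

(* The dollar sign is shared with the coefficients of formal power series. *)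
no_notation fps_nth (infixl \<open>$\<close> 75)

section \<open>Evaluation of polynomials in several variables\<close>

definition eval_monom :: "('v \<Rightarrow> 'b) \<Rightarrow> ('v \<Rightarrow>\<^sub>0 nat) \<Rightarrow> 'b::comm_ring_1" where
  "eval_monom x m = (\<Prod>i\<in>Poly_Mapping.keys m. x i ^ Poly_Mapping.lookup m i)"

lemma eval_monom_superset:
  assumes "finite S" "Poly_Mapping.keys m \<subseteq> S"
  shows "eval_monom x m = (\<Prod>i\<in>S. x i ^ Poly_Mapping.lookup m i)"
  unfolding eval_monom_def using assms by (intro prod.mono_neutral_left) (auto simp: in_keys_iff)

lemma eval_monom_0 [simp]: "eval_monom x 0 = 1"
  by (simp add: eval_monom_def)

lemma eval_monom_add: "eval_monom x (m + n) = eval_monom x m * eval_monom x n"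
proof -
  let ?S = "Poly_Mapping.keys m \<union> Poly_Mapping.keys n"
  have S: "finite ?S" by simp
  have "Poly_Mapping.keys (m + n) \<subseteq> ?S" by (rule Poly_Mapping.keys_add)
  then show ?thesis
    by (simp add: eval_monom_superset[OF S] lookup_add power_add prod.distrib)
qed

lemma eval_monom_single: "eval_monom x (Poly_Mapping.single i k) = x i ^ k"
  by (cases "k = 0") (auto simp: eval_monom_def)

lemma mpoly_eval_superset:
  assumes "finite S" "Poly_Mapping.keys P \<subseteq> S" "h 0 = 0"
  shows "mpoly_eval h P x = (\<Sum>m\<in>S. h (Poly_Mapping.lookup P m) * eval_monom x m)"
  unfolding mpoly_eval_def eval_monom_def[symmetric] using assms
  by (intro sum.mono_neutral_left) (auto simp: in_keys_iff)

lemma mpoly_eval_single: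
  "h 0 = 0 \<Longrightarrow> mpoly_eval h (Poly_Mapping.single m c) x = h c * eval_monom x m"
  by (subst mpoly_eval_superset[of "{m}"]) auto

lemma mpoly_eval_add:
  assumes h: "h 0 = 0" "\<And>a b. h (a + b) = h a + h b"
  shows "mpoly_eval h (P + Q) x = mpoly_eval h P x + mpoly_eval h Q x"
proof -
  let ?S = "Poly_Mapping.keys P \<union> Poly_Mapping.keys Q"
  have S: "finite ?S" "Poly_Mapping.keys P \<subseteq> ?S" "Poly_Mapping.keys Q \<subseteq> ?S" by auto
  show ?thesis
    using mpoly_eval_superset[of ?S "P + Q" h x, OF S(1) Poly_Mapping.keys_add h(1)]
      mpoly_eval_superset[of ?S P h x, OF S(1,2) h(1)] mpoly_eval_superset[of ?S Q h x, OF S(1,3) h(1)]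
    by (simp add: lookup_add h(2) sum.distrib distrib_right)
qed

lemma mpoly_eval_0 [simp]: "mpoly_eval h 0 x = 0"
  by (simp add: mpoly_eval_def)

lemma mpoly_eval_sum:
  assumes "h 0 = 0" "\<And>a b. h (a + b) = h a + h b"
  shows "mpoly_eval h (\<Sum>r\<in>I. P r) x = (\<Sum>r\<in>I. mpoly_eval h (P r) x)"
  by (induction I rule: infinite_finite_induct) (simp_all add: mpoly_eval_add[OF assms])

lemma mpoly_eq_sum_single:
  "P = (\<Sum>m\<in>Poly_Mapping.keys P. Poly_Mapping.single m (Poly_Mapping.lookup P m))"
  by (rule poly_mapping_eqI)
    (auto simp: lookup_sum lookup_single when_def sum.delta in_keys_iff)

lemma mpoly_eval_mult:
  fixes P Q :: "('v, 'a::comm_ring_1) mpoly"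
  shows "mpoly_eval id (P * Q) x = mpoly_eval id P x * mpoly_eval id Q x"
proof -
  have "P * Q = (\<Sum>m\<in>Poly_Mapping.keys P. \<Sum>n\<in>Poly_Mapping.keys Q.
      Poly_Mapping.single (m + n) (Poly_Mapping.lookup P m * Poly_Mapping.lookup Q n))"
    by (subst mpoly_eq_sum_single[of P], subst mpoly_eq_sum_single[of Q])
      (simp add: sum_product mult_single)
  also have "mpoly_eval id \<dots> x = (\<Sum>m\<in>Poly_Mapping.keys P. \<Sum>n\<in>Poly_Mapping.keys Q.
      (Poly_Mapping.lookup P m * eval_monom x m) * (Poly_Mapping.lookup Q n * eval_monom x n))"
    by (simp add: mpoly_eval_sum mpoly_eval_single eval_monom_add mult_ac)
  also have "\<dots> = mpoly_eval id P x * mpoly_eval id Q x"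
    by (simp add: mpoly_eval_def eval_monom_def[symmetric] sum_product)
  finally show ?thesis .
qed

lemma mpoly_pderiv_superset:
  assumes "finite S" "Poly_Mapping.keys P \<subseteq> S"
  shows "mpoly_pderiv i P = (\<Sum>m\<in>S. Poly_Mapping.single (m - Poly_Mapping.single i 1)
        (of_nat (Poly_Mapping.lookup m i) * Poly_Mapping.lookup P m))"
  unfolding mpoly_pderiv_def using assms
  by (intro sum.mono_neutral_left) (auto simp: in_keys_iff)

lemma mpoly_pderiv_add: "mpoly_pderiv i (P + Q) = mpoly_pderiv i P + mpoly_pderiv i Q"
proof -
  let ?S = "Poly_Mapping.keys P \<union> Poly_Mapping.keys Q"
  have S: "finite ?S" "Poly_Mapping.keys P \<subseteq> ?S" "Poly_Mapping.keys Q \<subseteq> ?S" by auto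
  show ?thesis
    using mpoly_pderiv_superset[of ?S "P + Q" i, OF S(1) Poly_Mapping.keys_add]
      mpoly_pderiv_superset[of ?S P i, OF S(1,2)] mpoly_pderiv_superset[of ?S Q i, OF S(1,3)]
    by (simp add: lookup_add sum.distrib distrib_left single_add)
qed

lemma mpoly_pderiv_0 [simp]: "mpoly_pderiv i 0 = 0"
  by (simp add: mpoly_pderiv_def)

section \<open>Polynomial functions on the space of quintics\<close>

text \<open>
  The coordinates with \<open>j > 5\<close> vanish on the quintics; allowing them spares a side condition.
\<close>
definition polynomial_function :: "('a::field poly ^ 5 \<Rightarrow> 'a) \<Rightarrow> bool" where
  "polynomial_function \<phi> \<longleftrightarrow>
     (\<exists>P :: (5 \<times> nat, 'a) mpoly. \<forall>f. mpoly_eval id P (\<lambda>(i, j). coeff (f $ i) j) = \<phi> f)"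

lemma polynomial_function_const: "polynomial_function (\<lambda>f. c)"
  unfolding polynomial_function_def
  by (rule exI[of _ "Poly_Mapping.single 0 c"]) (simp add: mpoly_eval_single)

lemma polynomial_function_coeff: "polynomial_function (\<lambda>f. coeff (f $ i) j)"
  unfolding polynomial_function_def
  by (rule exI[of _ "Poly_Mapping.single (Poly_Mapping.single (i, j) 1) 1"])
    (simp add: mpoly_eval_single eval_monom_single)

lemma polynomial_function_add:
  "polynomial_function \<phi> \<Longrightarrow> polynomial_function \<psi> \<Longrightarrow> polynomial_function (\<lambda>f. \<phi> f + \<psi> f)"
  unfolding polynomial_function_def by (metis mpoly_eval_add[of id] id_apply)

lemma polynomial_function_mult:
  "polynomial_function \<phi> \<Longrightarrow> polynomial_function \<psi> \<Longrightarrow> polynomial_function (\<lambda>f. \<phi> f * \<psi> f)"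
  unfolding polynomial_function_def by (metis mpoly_eval_mult)

lemma polynomial_function_uminus:
  "polynomial_function \<phi> \<Longrightarrow> polynomial_function (\<lambda>f. - \<phi> f)"
  using polynomial_function_mult[OF polynomial_function_const[of "- 1"]] by simp

lemma polynomial_function_diff:
  "polynomial_function \<phi> \<Longrightarrow> polynomial_function \<psi> \<Longrightarrow> polynomial_function (\<lambda>f. \<phi> f - \<psi> f)"
  using polynomial_function_add[OF _ polynomial_function_uminus] by force

lemma polynomial_function_sum:
  "(\<And>r. r \<in> I \<Longrightarrow> polynomial_function (\<phi> r)) \<Longrightarrow> polynomial_function (\<lambda>f. \<Sum>r\<in>I. \<phi> r f)"
  by (induction I rule: infinite_finite_induct)
    (auto intro: polynomial_function_const polynomial_function_add)

lemma polynomial_function_prod: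
  "(\<And>r. r \<in> I \<Longrightarrow> polynomial_function (\<phi> r)) \<Longrightarrow> polynomial_function (\<lambda>f. \<Prod>r\<in>I. \<phi> r f)"
  by (induction I rule: infinite_finite_induct)
    (auto intro: polynomial_function_const polynomial_function_mult)

text \<open>
  A morphism from the affine space of 5-tuples to the space of polynomials in one variable.
\<close>
definition polynomial_family :: "('a::field poly ^ 5 \<Rightarrow> 'a poly) \<Rightarrow> bool" where
  "polynomial_family \<Phi> \<longleftrightarrow> (\<forall>n. polynomial_function (\<lambda>f. coeff (\<Phi> f) n))"

lemma polynomial_family_const: "polynomial_family (\<lambda>f. p)"
  by (simp add: polynomial_family_def polynomial_function_const)

lemma polynomial_family_component: "polynomial_family (\<lambda>f. f $ i)"
  by (simp add: polynomial_family_def polynomial_function_coeff)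

lemma polynomial_family_add:
  "polynomial_family \<Phi> \<Longrightarrow> polynomial_family \<Psi> \<Longrightarrow> polynomial_family (\<lambda>f. \<Phi> f + \<Psi> f)"
  by (simp add: polynomial_family_def polynomial_function_add)

lemma polynomial_family_mult:
  "polynomial_family \<Phi> \<Longrightarrow> polynomial_family \<Psi> \<Longrightarrow> polynomial_family (\<lambda>f. \<Phi> f * \<Psi> f)"
  by (auto simp: polynomial_family_def coeff_mult
      intro!: polynomial_function_sum polynomial_function_mult)

lemma polynomial_family_smult:
  "polynomial_function \<phi> \<Longrightarrow> polynomial_family \<Psi> \<Longrightarrow> polynomial_family (\<lambda>f. smult (\<phi> f) (\<Psi> f))"
  by (auto simp: polynomial_family_def intro!: polynomial_function_mult)

lemma polynomial_family_sum:
  "(\<And>r. r \<in> I \<Longrightarrow> polynomial_family (\<Phi> r)) \<Longrightarrow> polynomial_family (\<lambda>f. \<Sum>r\<in>I. \<Phi> r f)"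
  by (auto simp: polynomial_family_def coeff_sum intro!: polynomial_function_sum)

lemma polynomial_family_prod:
  "(\<And>r. r \<in> I \<Longrightarrow> polynomial_family (\<Phi> r)) \<Longrightarrow> polynomial_family (\<lambda>f. \<Prod>r\<in>I. \<Phi> r f)"
  by (induction I rule: infinite_finite_induct)
    (auto intro: polynomial_family_const polynomial_family_mult)

lemma polynomial_family_power:
  "polynomial_family \<Phi> \<Longrightarrow> polynomial_family (\<lambda>f. \<Phi> f ^ n)"
  by (induction n) (auto intro: polynomial_family_const polynomial_family_mult)

lemma polynomial_family_eval_monom: "polynomial_family (\<lambda>f. eval_monom (($) f) m)"
  unfolding eval_monom_def
  by (intro polynomial_family_prod polynomial_family_power polynomial_family_component)

lemma polynomial_function_det:
  fixes A :: "'a::field poly ^ 5 \<Rightarrow> 'a ^ 'n ^ 'n"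
  assumes "\<And>i k. polynomial_function (\<lambda>f. A f $ i $ k)"
  shows "polynomial_function (\<lambda>f. det (A f))"
  unfolding det_def
  by (intro polynomial_function_sum polynomial_function_mult polynomial_function_prod
      polynomial_function_const assms)

text \<open>
  Expanding in a basis is an open condition, and by Cramer's rule the coefficients are polynomial up
  to the determinant \<open>D\<close>. The family \<open>L\<close> specialises at \<open>f0\<close> to the monomial basis, where the
  coefficient matrix is the unit matrix; hence \<open>D f0 = 1\<close> and the coefficients at \<open>f0\<close> are those of
  \<open>B f0\<close>. The type \<open>'n\<close>, with \<open>d + 1\<close> elements, indexes the rows and columns of this matrix.
\<close>
lemma open_basis_criterion:
  fixes L :: "nat \<Rightarrow> 'a::field poly ^ 5 \<Rightarrow> 'a poly" and e :: "'n::finite \<Rightarrow> nat"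
  assumes e: "bij_betw e UNIV {..d}"
    and L: "\<And>k. k \<le> d \<Longrightarrow> polynomial_family (L k)"
    and f0: "\<And>k. k \<le> d \<Longrightarrow> L k f0 = monom 1 k"
  obtains D where "polynomial_function D" "D f0 = 1"
    "\<And>B. polynomial_family B \<Longrightarrow> \<exists>x. (\<forall>k\<le>d. polynomial_function (x k)) \<and>
       (\<forall>k\<le>d. x k f0 = coeff (B f0) k) \<and>
       (\<forall>f. D f \<noteq> 0 \<longrightarrow> degree (B f) \<le> d \<longrightarrow> (\<forall>k\<le>d. degree (L k f) \<le> d) \<longrightarrow>
          (\<Sum>k\<le>d. smult (x k f) (L k f)) = smult (D f) (B f))"
proof -
  define A where "A f = (\<chi> i k. coeff (L (e k) f) (e i))" for f :: "'a poly ^ 5"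
  define D where "D f = det (A f)" for f
  have e_le: "e k \<le> d" for k using e by (auto simp: bij_betw_def)
  have inj: "e i = e k \<longleftrightarrow> i = k" for i k
    using e by (auto simp: bij_betw_def inj_on_def)
  have A: "polynomial_function (\<lambda>f. A f $ i $ k)" for i k
    using L[OF e_le] by (simp add: A_def polynomial_family_def)
  have A0: "A f0 = mat 1"
    by (simp add: A_def f0 e_le mat_def vec_eq_iff inj eq_commute)
  have "polynomial_function D"
    unfolding D_def by (rule polynomial_function_det[OF A])
  moreover have "D f0 = 1" by (simp add: D_def A0)
  moreover have "\<exists>x. (\<forall>k\<le>d. polynomial_function (x k)) \<and>
       (\<forall>k\<le>d. x k f0 = coeff (B f0) k) \<and>
       (\<forall>f. D f \<noteq> 0 \<longrightarrow> degree (B f) \<le> d \<longrightarrow> (\<forall>k\<le>d. degree (L k f) \<le> d) \<longrightarrow>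
          (\<Sum>k\<le>d. smult (x k f) (L k f)) = smult (D f) (B f))"
    if B: "polynomial_family B" for B
  proof -
    define b where "b f = (\<chi> i. coeff (B f) (e i))" for f
    define c where "c k f = det (\<chi> i j. if j = k then b f $ i else A f $ i $ j)" for k :: 'n and f
    define x where "x k f = c (inv_into UNIV e k) f" for k f
    have xe: "x (e k) f = c k f" for k f
      using e by (simp add: x_def bij_betw_def)
    have ex: "\<exists>i. k = e i" if "k \<le> d" for k using e that by (auto simp: bij_betw_def)
    have pc: "polynomial_function (c k)" for k
      unfolding c_def
    proof (rule polynomial_function_det)
      fix i j
      show "polynomial_function (\<lambda>f. (\<chi> i j. if j = k then b f $ i else A f $ i $ j) $ i $ j)"
        using A[of i j] B by (cases "j = k") (simp_all add: b_def polynomial_family_def)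
    qed
    have "x k f0 = coeff (B f0) k" if k: "k \<le> d" for k
    proof -
      obtain i where i: "k = e i" using ex[OF k] by blast
      have "c i f0 = (b f0) $ i * det (A f0)"
        using cramer_lemma[of i "A f0" "b f0"] unfolding c_def A0 matrix_vector_mul_lid by simp
      then show ?thesis by (simp add: i xe A0 b_def)
    qed
    moreover have "(\<Sum>k\<le>d. smult (x k f) (L k f)) = smult (D f) (B f)"
      if D: "D f \<noteq> 0" and dB: "degree (B f) \<le> d" and dL: "\<forall>k\<le>d. degree (L k f) \<le> d" for f
    proof -
      define z where "z = (\<chi> k. c k f / D f)"
      have "A f *v z = b f"
        using D by (subst cramer) (simp_all add: D_def z_def c_def)
      then have *: "(\<Sum>k\<in>UNIV. A f $ i $ k * c k f) = D f * b f $ i" for i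
        using D by (auto simp: vec_eq_iff matrix_vector_mult_def z_def sum_divide_distrib[symmetric] field_simps)
      have "coeff (\<Sum>k\<le>d. smult (x k f) (L k f)) n = coeff (smult (D f) (B f)) n" for n
      proof (cases "n \<le> d")
        case True
        then obtain i where i: "n = e i" using ex by blast
        have "(\<Sum>k\<le>d. x k f * coeff (L k f) n) = (\<Sum>k\<in>UNIV. x (e k) f * coeff (L (e k) f) n)"
          using sum.reindex_bij_betw[OF e, of "\<lambda>k. x k f * coeff (L k f) n"] by simp
        also have "\<dots> = (\<Sum>k\<in>UNIV. A f $ i $ k * c k f)"
          by (simp add: xe A_def i mult.commute)
        finally show ?thesis using *[of i] by (simp add: coeff_sum b_def i)
      next
        case False
        then have "coeff (B f) n = 0" "\<And>k. k \<le> d \<Longrightarrow> coeff (L k f) n = 0"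
          using dB dL by (auto intro!: coeff_eq_0 simp: not_le intro: le_less_trans)
        then show ?thesis by (simp add: coeff_sum)
      qed
      then show ?thesis by (intro poly_eqI)
    qed
    ultimately show ?thesis using pc by (intro exI[of _ x]) (auto simp: x_def[abs_def])
  qed
  ultimately show ?thesis by (rule that)
qed

section \<open>An open condition for closed embeddings\<close>

definition monomial_quintic :: "(5 \<Rightarrow> nat) \<Rightarrow> 'a::field poly ^ 5" where
  "monomial_quintic ex = (\<chi> i. monom 1 (ex i))"

text \<open>
  The determinant of the Hankel matrix with rows \<open>(l 1, l 2, l 3)\<close>, \<open>(l 2, l 3, l 4)\<close>, \<open>(l 3, l 4, l 5)\<close>.
\<close>
definition hankel :: "(nat \<Rightarrow> 'a::comm_ring_1) \<Rightarrow> 'a" where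
  "hankel l = l 1 * (l 3 * l 5 - l 4 * l 4) - l 2 * (l 2 * l 5 - l 3 * l 4)
     + l 3 * (l 2 * l 4 - l 3 * l 3)"

text \<open>
  Each coordinate is multiplied by the determinant through a row of the adjugate matrix.
\<close>
lemma hankel_kernel:
  fixes l :: "nat \<Rightarrow> 'a::field"
  assumes H: "hankel l \<noteq> 0"
    and 1: "q0 * l 1 + q1 * l 2 + q2 * l 3 = 0"
    and 2: "q0 * l 2 + q1 * l 3 + q2 * l 4 = 0"
    and 3: "q0 * l 3 + q1 * l 4 + q2 * l 5 = 0"
  shows "q0 = 0 \<and> q1 = 0 \<and> q2 = 0"
proof -
  have "q0 * hankel l = (l 3 * l 5 - l 4 * l 4) * (q0 * l 1 + q1 * l 2 + q2 * l 3)
      - (l 2 * l 5 - l 3 * l 4) * (q0 * l 2 + q1 * l 3 + q2 * l 4)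
      + (l 2 * l 4 - l 3 * l 3) * (q0 * l 3 + q1 * l 4 + q2 * l 5)"
    unfolding hankel_def by algebra
  moreover have "q1 * hankel l = - (l 2 * l 5 - l 3 * l 4) * (q0 * l 1 + q1 * l 2 + q2 * l 3)
      + (l 1 * l 5 - l 3 * l 3) * (q0 * l 2 + q1 * l 3 + q2 * l 4)
      - (l 1 * l 4 - l 2 * l 3) * (q0 * l 3 + q1 * l 4 + q2 * l 5)"
    unfolding hankel_def by algebra
  moreover have "q2 * hankel l = (l 2 * l 4 - l 3 * l 3) * (q0 * l 1 + q1 * l 2 + q2 * l 3)
      - (l 1 * l 4 - l 2 * l 3) * (q0 * l 2 + q1 * l 3 + q2 * l 4)
      + (l 1 * l 3 - l 2 * l 2) * (q0 * l 3 + q1 * l 4 + q2 * l 5)"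
    unfolding hankel_def by algebra
  ultimately show ?thesis using H unfolding 1 2 3 by simp
qed

text \<open>
  Here \<open>\<phi>\<close> is a linear functional on the quintic forms, given by its values on the monomials, which
  vanishes on all components of \<open>f\<close>. The three equations say that it also vanishes on the multiples by
  \<open>t, t\<^sup>2, t\<^sup>3\<close> of the quadratic form with coefficients \<open>q0, q1, q2\<close>. Functionals that factor through
  a subscheme of length 2 of the line are of this kind, so the condition implies that the centre of
  the projection of the rational normal curve is off all its secants and tangents.
\<close>
definition no_secant_functional :: "'a::field poly ^ 5 \<Rightarrow> bool" where
  "no_secant_functional f \<longleftrightarrow> (\<forall>\<phi> q0 q1 q2.
     (\<forall>i. (\<Sum>j\<le>5. coeff (f $ i) j * \<phi> j) = 0) \<longrightarrow>
     q0 * \<phi> 1 + q1 * \<phi> 2 + q2 * \<phi> 3 = 0 \<longrightarrow>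
     q0 * \<phi> 2 + q1 * \<phi> 3 + q2 * \<phi> 4 = 0 \<longrightarrow>
     q0 * \<phi> 3 + q1 * \<phi> 4 + q2 * \<phi> 5 = 0 \<longrightarrow>
     (q0, q1, q2) \<noteq> (0, 0, 0) \<longrightarrow> (\<forall>j\<le>5. \<phi> j = 0))"

lemma pderiv_sum: "pderiv (\<Sum>r\<in>I. p r) = (\<Sum>r\<in>I. pderiv (p r))"
  by (induction I rule: infinite_finite_induct) (simp_all add: pderiv_add)

lemma poly_eq_sum_upto:
  fixes p :: "'a::field poly"
  shows "degree p \<le> n \<Longrightarrow> poly p a = (\<Sum>j\<le>n. coeff p j * a ^ j)"
  by (subst poly_as_sum_of_monoms'[symmetric, of p n]) (simp_all add: poly_sum poly_monom)

lemma poly_pderiv_eq_sum_upto: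
  fixes p :: "'a::field poly"
  shows "degree p \<le> n \<Longrightarrow> poly (pderiv p) a = (\<Sum>j\<le>n. coeff p j * (of_nat j * a ^ (j - 1)))"
  by (subst poly_as_sum_of_monoms'[symmetric, of p n])
    (simp_all add: poly_sum poly_monom pderiv_sum pderiv_monom mult_ac)

text \<open>
  A failure of a closed embedding is a linear dependence between values of \<open>f\<close> (and of its
  derivative) at the points of a subscheme of length at most 2, hence a functional that vanishes on the components
  of \<open>f\<close> and on the multiples of the quadratic form defining the subscheme. The quadrics in
  the four parts of the proof vanish at the point in question, at both points, and twice at the point
  on chart 0 and on chart 1.
\<close>
lemma smooth_rational_quinticI:
  fixes f :: "'a::field poly ^ 5"
  assumes f: "f \<in> quintic_tuples" and sec: "no_secant_functional f"
  shows "smooth_rational_quintic f"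
proof -
  have deg: "degree (f $ i) \<le> 5" for i using f by (simp add: quintic_tuples_def)
  have sec: "\<phi> j = 0" if "\<And>i. (\<Sum>j\<le>5. coeff (f $ i) j * \<phi> j) = 0"
     "q0 * \<phi> 1 + q1 * \<phi> 2 + q2 * \<phi> 3 = 0"
     "q0 * \<phi> 2 + q1 * \<phi> 3 + q2 * \<phi> 4 = 0"
     "q0 * \<phi> 3 + q1 * \<phi> 4 + q2 * \<phi> 5 = 0" "(q0, q1, q2) \<noteq> (0, 0, 0)" "j \<le> 5" for \<phi> q0 q1 q2 j
    using sec that unfolding no_secant_functional_def by blast
  have nonzero: "curve_point f s t \<noteq> 0" if st: "(s, t) \<noteq> (0, 0)" for s t
  proof
    assume 0: "curve_point f s t = 0"
    define \<phi> where "\<phi> j = s ^ (5 - j) * t ^ j" for j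
    have "\<phi> j = 0" if "j \<le> 5" for j
    proof (rule sec[OF _ _ _ _ _ that, of \<phi> "- t" s 0])
      show "(\<Sum>j\<le>5. coeff (f $ i) j * \<phi> j) = 0" for i
        using 0 by (simp add: curve_point_def vec_eq_iff \<phi>_def mult.assoc)
    qed (use st in \<open>auto simp: \<phi>_def eval_nat_numeral algebra_simps\<close>)
    from this[of 0] this[of 5] st show False by (simp add: \<phi>_def)
  qed
  have injective: "s * t' = s' * t"
    if st: "(s, t) \<noteq> (0, 0)" and st': "(s', t') \<noteq> (0, 0)"
      and c: "curve_point f s' t' = c *s curve_point f s t" for s t s' t' c
  proof -
    define \<phi> where "\<phi> j = s' ^ (5 - j) * t' ^ j - c * (s ^ (5 - j) * t ^ j)" for j
    have \<phi>: "\<phi> j = 0" if "j \<le> 5" for j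
    proof (rule sec[OF _ _ _ _ _ that, of \<phi> "t * t'" "- (s * t' + s' * t)" "s * s'"])
      show "(\<Sum>j\<le>5. coeff (f $ i) j * \<phi> j) = 0" for i
        using c by (simp add: curve_point_def vec_eq_iff \<phi>_def mult.assoc right_diff_distrib
            sum_subtractf sum_distrib_left mult.left_commute)
      show "(t * t', - (s * t' + s' * t), s * s') \<noteq> (0, 0, 0)"
        using st st' by auto
    qed (simp_all add: \<phi>_def eval_nat_numeral algebra_simps)
    have 0: "s' ^ 5 = c * s ^ 5" and 1: "s' ^ 4 * t' = c * (s ^ 4 * t)" and 5: "t' ^ 5 = c * t ^ 5"
      using \<phi>[of 0] \<phi>[of 1] \<phi>[of 5] by (simp_all add: \<phi>_def)
    show ?thesis
    proof (cases "s' = 0")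
      case True
      then have "t' \<noteq> 0" using st' by simp
      then have "c \<noteq> 0" using 5 by auto
      then show ?thesis using True 0 by simp
    next
      case False
      have "s' ^ 4 * (s * t') = s * (s' ^ 4 * t')" by (simp add: mult_ac)
      also have "\<dots> = (c * s ^ 5) * t" unfolding 1 by (simp add: eval_nat_numeral mult_ac)
      also have "\<dots> = s' ^ 4 * (s' * t)" unfolding 0[symmetric] by (simp add: eval_nat_numeral mult_ac)
      finally have "s' ^ 4 * (s * t') = s' ^ 4 * (s' * t)" .
      then show ?thesis using False by simp
    qed
  qed
  have imm0: "immersive f"
    unfolding immersive_def
  proof (intro allI impI)
    fix a \<alpha> \<beta>
    assume ab: "\<alpha> *s poly_vec f a + \<beta> *s poly_vec (pderiv_vec f) a = 0"
    define \<phi> where "\<phi> j = \<alpha> * a ^ j + \<beta> * (of_nat j * a ^ (j - 1))" for j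
    have \<phi>: "\<phi> j = 0" if "j \<le> 5" for j
    proof (rule sec[OF _ _ _ _ _ that, of \<phi> "a * a" "- (2 * a)" 1])
      fix i
      have "\<alpha> * poly (f $ i) a + \<beta> * poly (pderiv (f $ i)) a = 0"
        using ab by (simp add: vec_eq_iff poly_vec_def pderiv_vec_def)
      then show "(\<Sum>j\<le>5. coeff (f $ i) j * \<phi> j) = 0"
        by (simp add: poly_eq_sum_upto[OF deg] poly_pderiv_eq_sum_upto[OF deg] \<phi>_def
            distrib_left sum.distrib sum_distrib_left mult.left_commute)
    qed (simp_all add: \<phi>_def eval_nat_numeral algebra_simps)
    from \<phi>[of 0] \<phi>[of 1] show "\<alpha> = 0 \<and> \<beta> = 0" by (simp add: \<phi>_def)
  qed
  have imm1: "immersive (chart1 f)"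
    unfolding immersive_def
  proof (intro allI impI)
    fix a \<alpha> \<beta>
    assume ab: "\<alpha> *s poly_vec (chart1 f) a + \<beta> *s poly_vec (pderiv_vec (chart1 f)) a = 0"
    define \<phi> where "\<phi> j = \<alpha> * a ^ (5 - j) + \<beta> * (of_nat (5 - j) * a ^ (5 - j - 1))" for j
    have \<phi>: "\<phi> j = 0" if "j \<le> 5" for j
    proof (rule sec[OF _ _ _ _ _ that, of \<phi> 1 "- (2 * a)" "a * a"])
      fix i
      have "\<alpha> * poly (chart1 f $ i) a + \<beta> * poly (pderiv (chart1 f $ i)) a = 0"
        using ab by (simp add: vec_eq_iff poly_vec_def pderiv_vec_def)
      then show "(\<Sum>j\<le>5. coeff (f $ i) j * \<phi> j) = 0"
        by (simp add: chart1_def poly_sum poly_monom pderiv_sum pderiv_monom \<phi>_def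
            distrib_left sum.distrib sum_distrib_left mult_ac)
    qed (simp_all add: \<phi>_def eval_nat_numeral algebra_simps)
    from \<phi>[of 5] \<phi>[of 4] show "\<alpha> = 0 \<and> \<beta> = 0" by (simp add: \<phi>_def)
  qed
  show ?thesis
    unfolding smooth_rational_quintic_def using f nonzero injective imm0 imm1 by blast
qed

text \<open>
  For \<open>f\<close> near the monomial quintic, the components of \<open>f\<close> and \<open>t\<^sup>3\<close>, the omitted monomial, are a basis of
  the quintics. A functional that vanishes on the components is then determined by its value at \<open>t\<^sup>3\<close>,
  so it is a multiple of the functional \<open>l f\<close> whose values on the monomials are polynomial in \<open>f\<close>.
  Its Hankel determinant is \<open>-1\<close> at the monomial quintic, and where it does not vanish no
  quadratic form as in \<open>no_secant_functional\<close> exists.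
\<close>
lemma general_quintic_smooth:
  assumes ex: "bij_betw ex UNIV {0, 1, 2, 4, 5::nat}"
  obtains P where "polynomial_function P" "P (monomial_quintic ex :: 'a::field poly ^ 5) \<noteq> 0"
    "\<And>f :: 'a poly ^ 5. f \<in> quintic_tuples \<Longrightarrow> P f \<noteq> 0 \<Longrightarrow> smooth_rational_quintic f"
proof -
  let ?f0 = "monomial_quintic ex :: 'a poly ^ 5"
  define iv where "iv = inv_into UNIV ex"
  have iv: "ex (iv k) = k" if "k \<le> 5" "k \<noteq> 3" for k
  proof -
    have "k \<in> {0, 1, 2, 4, 5}" using that by auto
    then show ?thesis using ex by (metis bij_betw_imp_surj_on f_inv_into_f iv_def)
  qed
  define L :: "nat \<Rightarrow> 'a poly ^ 5 \<Rightarrow> 'a poly" where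
    "L k f = (if k = 3 then monom 1 3 else f $ iv k)" for k f
  have "card (UNIV :: 6 set) = card {..5::nat}" by simp
  then obtain e :: "6 \<Rightarrow> nat" where e: "bij_betw e UNIV {..5}"
    using finite_same_card_bij[of "UNIV :: 6 set" "{..5::nat}"] by auto
  have pL: "polynomial_family (L k)" for k
    by (cases "k = 3") (simp_all add: L_def[abs_def] polynomial_family_const polynomial_family_component)
  have L0: "L k ?f0 = monom 1 k" if "k \<le> 5" for k
    using iv[OF that] by (simp add: L_def monomial_quintic_def)
  obtain D where D: "polynomial_function D" "D ?f0 = 1"
    and solve: "\<And>B. polynomial_family B \<Longrightarrow> \<exists>x. (\<forall>k\<le>5. polynomial_function (x k)) \<and>
       (\<forall>k\<le>5. x k ?f0 = coeff (B ?f0) k) \<and>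
       (\<forall>f. D f \<noteq> 0 \<longrightarrow> degree (B f) \<le> 5 \<longrightarrow> (\<forall>k\<le>5. degree (L k f) \<le> 5) \<longrightarrow>
          (\<Sum>k\<le>5. smult (x k f) (L k f)) = smult (D f) (B f))"
    by (rule open_basis_criterion[OF e, of L ?f0]) (use pL L0 in auto)
  have "\<forall>j. \<exists>x. (\<forall>k\<le>5. polynomial_function (x k)) \<and>
       (\<forall>k\<le>5. x k ?f0 = coeff (monom 1 j) k) \<and>
       (\<forall>f. D f \<noteq> 0 \<longrightarrow> degree (monom (1::'a) j) \<le> 5 \<longrightarrow> (\<forall>k\<le>5. degree (L k f) \<le> 5) \<longrightarrow>
          (\<Sum>k\<le>5. smult (x k f) (L k f)) = smult (D f) (monom 1 j))"
    using solve[OF polynomial_family_const] by blast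
  from choice[OF this] obtain x where x': "\<forall>j. (\<forall>k\<le>5. polynomial_function (x j k)) \<and>
       (\<forall>k\<le>5. x j k ?f0 = coeff (monom 1 j) k) \<and>
       (\<forall>f. D f \<noteq> 0 \<longrightarrow> degree (monom (1::'a) j) \<le> 5 \<longrightarrow> (\<forall>k\<le>5. degree (L k f) \<le> 5) \<longrightarrow>
          (\<Sum>k\<le>5. smult (x j k f) (L k f)) = smult (D f) (monom 1 j))" ..
  have x: "\<And>j k. k \<le> 5 \<Longrightarrow> polynomial_function (x j k)"
      "\<And>j k. k \<le> 5 \<Longrightarrow> x j k ?f0 = coeff (monom 1 j) k"
      "\<And>j f. D f \<noteq> 0 \<Longrightarrow> degree (monom (1::'a) j) \<le> 5 \<Longrightarrow> (\<forall>k\<le>5. degree (L k f) \<le> 5) \<Longrightarrow>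
          (\<Sum>k\<le>5. smult (x j k f) (L k f)) = smult (D f) (monom 1 j)"
    using x' by simp_all
  define l where "l f j = x j 3 f" for f j
  define P where "P f = D f * hankel (l f)" for f
  have pl: "polynomial_function (\<lambda>f. l f j)" for j
    unfolding l_def by (rule x(1)) simp
  have "polynomial_function P"
    unfolding P_def hankel_def
    by (intro polynomial_function_mult D(1) polynomial_function_add polynomial_function_diff pl)
  moreover have "P ?f0 \<noteq> 0"
    by (simp add: P_def D(2) hankel_def l_def x(2))
  moreover have "smooth_rational_quintic f" if f: "f \<in> quintic_tuples" and P: "P f \<noteq> 0" for f
  proof (rule smooth_rational_quinticI[OF f])
    have Df: "D f \<noteq> 0" and H: "hankel (l f) \<noteq> 0" using P by (auto simp: P_def)
    have dL: "\<forall>k\<le>5. degree (L k f) \<le> 5"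
      using f by (auto simp: L_def quintic_tuples_def degree_monom_le intro: order_trans[OF degree_monom_le])
    show "no_secant_functional f"
      unfolding no_secant_functional_def
    proof (intro allI impI)
      fix \<phi> q0 q1 q2 j
      assume \<phi>: "\<forall>i. (\<Sum>j\<le>5. coeff (f $ i) j * \<phi> j) = 0"
        and 1: "q0 * \<phi> 1 + q1 * \<phi> 2 + q2 * \<phi> 3 = 0"
        and 2: "q0 * \<phi> 2 + q1 * \<phi> 3 + q2 * \<phi> 4 = 0"
        and 3: "q0 * \<phi> 3 + q1 * \<phi> 4 + q2 * \<phi> 5 = 0"
        and q: "(q0, q1, q2) \<noteq> (0, 0, 0)" and j: "j \<le> (5::nat)"
      have multiple: "D f * \<phi> j = l f j * \<phi> 3" if j: "j \<le> 5" for j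
      proof -
        define \<Phi> where "\<Phi> p = (\<Sum>n\<le>5. coeff p n * \<phi> n)" for p
        have \<Phi>_smult: "\<Phi> (smult c p) = c * \<Phi> p" for c p
          by (simp add: \<Phi>_def sum_distrib_left mult.assoc)
        have \<Phi>_sum: "\<Phi> (\<Sum>k\<le>5. p k) = (\<Sum>k\<le>5. \<Phi> (p k))" for p :: "nat \<Rightarrow> 'a poly"
          unfolding \<Phi>_def coeff_sum sum_distrib_right by (rule sum.swap)
        have \<Phi>_monom: "\<Phi> (monom 1 j) = \<phi> j" if "j \<le> 5" for j
          using that by (simp add: \<Phi>_def if_distrib[of "\<lambda>x. x * _"] cong: if_cong)
        have "D f * \<phi> j = \<Phi> (smult (D f) (monom 1 j))"
          using \<Phi>_monom[OF j] by (simp add: \<Phi>_smult)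
        also have "\<dots> = \<Phi> (\<Sum>k\<le>5. smult (x j k f) (L k f))"
          using x(3)[OF Df _ dL, of j] j degree_monom_le[of "1::'a" j] by simp
        also have "\<dots> = (\<Sum>k\<le>5. x j k f * \<Phi> (L k f))"
          by (simp add: \<Phi>_sum \<Phi>_smult)
        also have "\<dots> = (\<Sum>k\<le>(5::nat). if k = 3 then x j 3 f * \<phi> 3 else 0)"
          using \<phi> \<Phi>_monom[of 3] by (intro sum.cong refl) (auto simp: L_def \<Phi>_def)
        also have "\<dots> = l f j * \<phi> 3" by (simp add: l_def)
        finally show ?thesis .
      qed
      have "\<phi> 3 = 0"
      proof (rule ccontr)
        assume ne: "\<phi> 3 \<noteq> 0"
        have scale: "q0 * l f a + q1 * l f b + q2 * l f c = 0"
          if "q0 * \<phi> a + q1 * \<phi> b + q2 * \<phi> c = 0" "a \<le> 5" "b \<le> 5" "c \<le> 5" for a b c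
        proof -
          have "\<phi> 3 * (q0 * l f a + q1 * l f b + q2 * l f c) = D f * (q0 * \<phi> a + q1 * \<phi> b + q2 * \<phi> c)"
            using multiple[OF that(2)] multiple[OF that(3)] multiple[OF that(4)]
            by (simp add: distrib_left mult.left_commute[of "D f"] mult.left_commute[of "\<phi> 3"] mult.commute[of "\<phi> 3"])
          then show ?thesis using that(1) ne by simp
        qed
        have "q0 = 0 \<and> q1 = 0 \<and> q2 = 0"
          by (rule hankel_kernel[OF H scale[OF 1] scale[OF 2] scale[OF 3]]) simp_all
        then show False using q by simp
      qed
      then show "\<phi> j = 0" using multiple[OF j] Df by simp
    qed
  qed
  ultimately show ?thesis by (rule that)
qed

section \<open>Relations of bounded degree\<close>

text \<open>
  Rank and nullity in spaces of infinite dimension, for the restriction of \<open>L\<close> to a subspace of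
  finite dimension.
\<close>
lemma (in vector_space_pair) kernel_basis:
  assumes L: "Vector_Spaces.linear s1 s2 L"
    and E: "finite E" "vs1.independent E" and T: "finite T" "vs2.independent T"
    and LE: "L ` vs1.span E = vs2.span T"
  obtains B where "finite B" "vs1.independent B" "vs1.span B = {v \<in> vs1.span E. L v = 0}"
    "card B + card T = card E"
proof -
  interpret L: Vector_Spaces.linear s1 s2 L by (rule L)
  define K where "K = {v \<in> vs1.span E. L v = 0}"
  have K: "vs1.subspace K"
    unfolding K_def vs1.subspace_def
    by (auto simp: vs1.span_zero vs1.span_add vs1.span_scale L.zero L.add L.scale)
  obtain B where B: "B \<subseteq> K" "vs1.independent B" "K \<subseteq> vs1.span B"
    by (rule vs1.basis_exists)
  have spB: "vs1.span B = K"
    using B K by (simp add: subset_antisym vs1.span_minimal)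
  have finB: "finite B"
    using vs1.independent_span_bound[OF E(1) B(2)] B(1) by (auto simp: K_def)
  have "\<forall>t\<in>T. \<exists>u. u \<in> vs1.span E \<and> L u = t"
    using LE vs2.span_superset[of T] by (metis imageE subsetD)
  then obtain u where u: "\<And>t. t \<in> T \<Longrightarrow> u t \<in> vs1.span E" "\<And>t. t \<in> T \<Longrightarrow> L (u t) = t"
    by metis
  have inj: "inj_on u T" by (metis inj_onI u(2))
  have disj: "B \<inter> u ` T = {}"
  proof -
    have "u t \<notin> B" if "t \<in> T" for t
      using B(1) u(2)[OF that] vs2.dependent_zero[of T] T(2) that by (auto simp: K_def)
    then show ?thesis by auto
  qed
  have LB: "L b = 0" if "b \<in> B" for b using that B(1) by (auto simp: K_def)
  let ?S = "B \<union> u ` T"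
  have finS: "finite ?S" using finB T(1) by simp
  have ind: "vs1.independent ?S"
  proof (rule vs1.independent_if_scalars_zero[OF finS])
    fix c x assume c: "(\<Sum>x\<in>?S. s1 (c x) x) = 0" and x: "x \<in> ?S"
    have eq: "(\<Sum>x\<in>B. s1 (c x) x) + (\<Sum>t\<in>T. s1 (c (u t)) (u t)) = 0"
      using c finB T(1) disj by (simp add: sum.union_disjoint sum.reindex[OF inj])
    have "L (\<Sum>x\<in>B. s1 (c x) x) + L (\<Sum>t\<in>T. s1 (c (u t)) (u t)) = 0"
      using eq by (metis L.add L.zero)
    then have "(\<Sum>t\<in>T. s2 (c (u t)) t) = 0"
      by (simp add: L.sum L.scale LB u(2))
    then have cT: "c (u t) = 0" if "t \<in> T" for t
      using that T vs2.dependent_finite[OF T(1)] by fastforce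
    then have "(\<Sum>x\<in>B. s1 (c x) x) = 0" using eq by simp
    then have "c x = 0" if "x \<in> B" for x
      using that B(2) vs1.dependent_finite[OF finB] by fastforce
    then show "c x = 0" using x cT by auto
  qed
  have "vs1.span E \<subseteq> vs1.span ?S"
  proof
    fix v assume v: "v \<in> vs1.span E"
    then have "L v \<in> vs2.span T" using LE by auto
    then obtain r where r: "L v = (\<Sum>t\<in>T. s2 (r t) t)"
      using vs2.span_finite[OF T(1)] by auto
    let ?w = "\<Sum>t\<in>T. s1 (r t) (u t)"
    have w: "?w \<in> vs1.span E" "?w \<in> vs1.span ?S"
      by (intro vs1.span_sum vs1.span_scale u(1), simp)
        (intro vs1.span_sum vs1.span_scale vs1.span_base, simp)
    have "L (v - ?w) = 0" by (simp add: L.diff L.sum L.scale u(2) r)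
    then have "v - ?w \<in> vs1.span B"
      using v w(1) by (simp add: spB K_def vs1.span_diff)
    then have "v - ?w \<in> vs1.span ?S" using vs1.span_mono[of B ?S] by auto
    then show "v \<in> vs1.span ?S" using w(2) by (metis vs1.span_add diff_add_cancel)
  qed
  moreover have "vs1.span ?S \<subseteq> vs1.span E"
    using B(1) u(1) by (intro vs1.span_minimal) (auto simp: K_def)
  ultimately have "card ?S = card E"
    using ind E(2) vs1.dim_eq_card[of ?S "?S"] vs1.dim_eq_card[of E ?S] by simp
  moreover have "card ?S = card B + card T"
    using finB T(1) disj by (simp add: card_Un_disjoint card_image[OF inj])
  ultimately show ?thesis
    using that[OF finB B(2)] spB by (simp add: K_def)
qed

interpretation poly_space: vector_space "smult :: 'a::field \<Rightarrow> 'a poly \<Rightarrow> 'a poly"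
  by standard (simp_all add: smult_add_right smult_add_left)

interpretation poly_vec_space: vector_space "\<lambda>(c::'a::field) (v::'a poly ^ 'n). [:c:] *s v"
  by standard (simp_all add: vec_eq_iff smult_add_right smult_add_left)

interpretation poly_vec_pair: vector_space_pair
  "\<lambda>(c::'a::field) (v::'a poly ^ 'n). [:c:] *s v" "smult :: 'a \<Rightarrow> 'a poly \<Rightarrow> 'a poly"
  ..

lemma span_monoms:
  "poly_space.span ((monom (1::'a::field)) ` {..n}) = {p. degree p \<le> n}" (is "?L = ?R")
proof
  have "poly_space.subspace {p :: 'a poly. degree p \<le> n}"
    unfolding poly_space.subspace_def
    by (auto intro: degree_add_le order_trans[OF degree_smult_le])
  then show "?L \<subseteq> ?R"
    by (intro poly_space.span_minimal) (auto simp: degree_monom_le intro: order_trans[OF degree_monom_le])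
  show "?R \<subseteq> ?L"
  proof
    fix p :: "'a poly" assume "p \<in> ?R"
    then have "p = (\<Sum>i\<le>n. smult (coeff p i) (monom 1 i))"
      by (simp add: smult_monom poly_as_sum_of_monoms')
    also have "\<dots> \<in> ?L" by (intro poly_space.span_sum poly_space.span_scale poly_space.span_base) auto
    finally show "p \<in> ?L" .
  qed
qed

lemma independent_monoms: "poly_space.independent ((monom (1::'a::field)) ` {..n})"
proof (rule poly_space.independent_if_scalars_zero)
  fix f :: "'a poly \<Rightarrow> 'a" and x :: "'a poly"
  assume s: "(\<Sum>x\<in>monom 1 ` {..n}. smult (f x) x) = 0" and x: "x \<in> monom 1 ` {..n}"
  have inj: "inj_on (monom (1::'a)) {..n}" by (auto simp: inj_on_def monom_eq_iff')
  have s': "(\<Sum>i\<le>n. monom (f (monom 1 i)) i) = 0"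
    using s by (simp add: sum.reindex[OF inj] smult_monom)
  obtain j where j: "j \<le> n" "x = monom 1 j" using x by auto
  have "coeff (\<Sum>i\<le>n. monom (f (monom 1 i)) i) j = f x"
    using j by (simp add: coeff_sum)
  then show "f x = 0" using s' by simp
qed simp

lemma card_monoms: "card ((monom (1::'a::field)) ` {..n}) = Suc n"
  by (subst card_image) (auto simp: inj_on_def monom_eq_iff')

definition axis_monom :: "'n \<times> nat \<Rightarrow> 'a::field poly ^ 'n" where
  "axis_monom = (\<lambda>(i, j). axis i (monom 1 j))"

lemma sum_axis_monom:
  "(\<Sum>p\<in>UNIV \<times> {..n}. [:g p:] *s axis_monom p) = (\<chi> i. \<Sum>j\<le>n. monom (g (i, j)) j)"
proof -
  have "(\<Sum>p\<in>UNIV \<times> {..n}. [:g p:] *s axis_monom p) $ i = (\<Sum>j\<le>n. monom (g (i, j)) j)" for i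
  proof -
    have "(\<Sum>p\<in>UNIV \<times> {..n}. [:g p:] *s axis_monom p) $ i =
        (\<Sum>k\<in>UNIV. \<Sum>j\<le>n. if k = i then monom (g (k, j)) j else 0)"
      by (simp add: sum.cartesian_product sum_component)
        (intro sum.cong, auto simp: axis_monom_def axis_def smult_monom)
    also have "\<dots> = (\<Sum>k\<in>UNIV. if k = i then \<Sum>j\<le>n. monom (g (k, j)) j else 0)"
      by (intro sum.cong) auto
    finally show ?thesis by simp
  qed
  then show ?thesis by (simp add: vec_eq_iff)
qed

lemma inj_axis_monom: "inj (axis_monom :: 'n \<times> nat \<Rightarrow> 'a::field poly ^ 'n)"
  by (auto simp: inj_def axis_monom_def axis_eq_axis monom_eq_iff')

lemma span_axis_monom:
  "poly_vec_space.span (axis_monom ` (UNIV \<times> {..n})) =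
     {v :: 'a::field poly ^ 'n. \<forall>i. degree (v $ i) \<le> n}" (is "?L = ?R")
proof
  have "poly_vec_space.subspace ?R"
    unfolding poly_vec_space.subspace_def
    by (auto intro: degree_add_le order_trans[OF degree_smult_le])
  then show "?L \<subseteq> ?R"
    by (intro poly_vec_space.span_minimal)
      (auto simp: axis_monom_def axis_def intro: order_trans[OF degree_monom_le])
  show "?R \<subseteq> ?L"
  proof
    fix v :: "'a poly ^ 'n" assume v: "v \<in> ?R"
    then have "v = (\<Sum>p\<in>UNIV \<times> {..n}. [:coeff (v $ fst p) (snd p):] *s axis_monom p)"
      by (simp add: sum_axis_monom vec_eq_iff poly_as_sum_of_monoms')
    also have "\<dots> \<in> ?L"
      by (intro poly_vec_space.span_sum poly_vec_space.span_scale poly_vec_space.span_base) auto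
    finally show "v \<in> ?L" .
  qed
qed

lemma independent_axis_monom:
  "poly_vec_space.independent (axis_monom ` (UNIV \<times> {..n}) :: ('a::field poly ^ 'n) set)"
proof (rule poly_vec_space.independent_if_scalars_zero)
  fix f :: "'a poly ^ 'n \<Rightarrow> 'a" and x :: "'a poly ^ 'n"
  assume s: "(\<Sum>x\<in>axis_monom ` (UNIV \<times> {..n}). [:f x:] *s x) = 0"
    and x: "x \<in> axis_monom ` (UNIV \<times> {..n})"
  have s': "(\<Sum>p\<in>UNIV \<times> {..n}. [:f (axis_monom p):] *s axis_monom p) = (0 :: 'a poly ^ 'n)"
    using s by (simp add: sum.reindex[OF inj_on_subset[OF inj_axis_monom]])
  obtain i :: 'n and j where j: "j \<le> n" "x = axis_monom (i, j)" using x by auto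
  have "(\<Sum>j\<le>n. monom (f (axis_monom (i, j))) j) = 0"
    using s' unfolding sum_axis_monom by (simp add: vec_eq_iff)
  moreover have "coeff (\<Sum>j\<le>n. monom (f (axis_monom (i, j))) j) j = f x"
    using j by (simp add: coeff_sum)
  ultimately show "f x = 0" by simp
qed simp

lemma card_axis_monom:
  "card (axis_monom ` (UNIV \<times> {..n}) :: ('a::field poly ^ 'n) set) = CARD('n) * Suc n"
  by (subst card_image[OF inj_on_subset[OF inj_axis_monom]]) auto

definition dot :: "'a::comm_ring_1 ^ 'n \<Rightarrow> 'a ^ 'n \<Rightarrow> 'a" where
  "dot G v = (\<Sum>i\<in>UNIV. G $ i * v $ i)"

lemma dot_add: "dot G (v + w) = dot G v + dot G w"
  by (simp add: dot_def algebra_simps sum.distrib)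

lemma dot_diff: "dot G (v - w) = dot G v - dot G w"
  by (simp add: dot_def algebra_simps sum_subtractf)

lemma dot_scale: "dot G (c *s v) = c * dot G v"
  by (simp add: dot_def algebra_simps sum_distrib_left)

lemma dot_0 [simp]: "dot G 0 = 0"
  by (simp add: dot_def)

lemma degree_dot_le:
  fixes G v :: "'a::comm_ring_1 poly ^ 'n"
  assumes "\<And>i. degree (G $ i) \<le> m" "\<And>i. degree (v $ i) \<le> n"
  shows "degree (dot G v) \<le> m + n"
  unfolding dot_def using assms
  by (intro degree_sum_le) (auto intro: order_trans[OF degree_mult_le] add_mono)

lemma kernel_dot_basis:
  fixes G :: "'a::field poly ^ 'n"
  assumes G: "\<And>i. degree (G $ i) \<le> d"
    and surj: "\<And>q. degree q \<le> d + n \<Longrightarrow> \<exists>w. (\<forall>i. degree (w $ i) \<le> n) \<and> dot G w = q"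
  obtains B where "finite B" "poly_vec_space.independent B"
    "poly_vec_space.span B = {v. (\<forall>i. degree (v $ i) \<le> n) \<and> dot G v = 0}"
    "card B + Suc (d + n) = CARD('n) * Suc n"
proof -
  have L: "Vector_Spaces.linear (\<lambda>(c::'a) v. [:c:] *s v) smult (dot G)"
    unfolding Vector_Spaces.linear_iff
    by (auto simp: dot_add dot_scale poly_space.vector_space_axioms poly_vec_space.vector_space_axioms)
  have LE: "dot G ` poly_vec_space.span (axis_monom ` (UNIV \<times> {..n})) =
      poly_space.span (monom 1 ` {..d + n})"
    unfolding span_axis_monom span_monoms
  proof (intro subset_antisym subsetI)
    fix q :: "'a poly"
    assume "q \<in> dot G ` {v. \<forall>i. degree (v $ i) \<le> n}"
    then show "q \<in> {p. degree p \<le> d + n}" using degree_dot_le[OF G] by auto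
  next
    fix q :: "'a poly"
    assume "q \<in> {p. degree p \<le> d + n}"
    then show "q \<in> dot G ` {v. \<forall>i. degree (v $ i) \<le> n}" using surj[of q] by auto
  qed
  obtain B where B: "finite B" "poly_vec_space.independent B"
    "poly_vec_space.span B =
       {v \<in> poly_vec_space.span (axis_monom ` (UNIV \<times> {..n})). dot G v = 0}"
    "card B + card (monom (1::'a) ` {..d + n}) =
       card (axis_monom ` (UNIV \<times> {..n}) :: ('a poly ^ 'n) set)"
    by (rule poly_vec_pair.kernel_basis[OF L _ independent_axis_monom _ independent_monoms LE]) auto
  show ?thesis
    using B(3,4) by (intro that[OF B(1,2)]) (simp_all add: span_axis_monom card_axis_monom card_monoms)
qed

section \<open>Change of chart\<close>

definition rev_poly :: "nat \<Rightarrow> 'a::field poly \<Rightarrow> 'a poly" where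
  "rev_poly n p = (\<Sum>j\<le>n. monom (coeff p j) (n - j))"

lemma coeff_rev_poly: "coeff (rev_poly n p) k = (if k \<le> n then coeff p (n - k) else 0)"
proof (cases "k \<le> n")
  case True
  have "coeff (rev_poly n p) k = (\<Sum>j\<le>n. if j = n - k then coeff p j else 0)"
    unfolding rev_poly_def coeff_sum using True by (intro sum.cong) auto
  then show ?thesis using True by simp
next
  case False
  then show ?thesis unfolding rev_poly_def coeff_sum by (auto intro!: sum.neutral)
qed

lemma degree_rev_poly: "degree (rev_poly n p) \<le> n"
  by (rule degree_le) (simp add: coeff_rev_poly)

lemma rev_poly_rev_poly: "degree p \<le> n \<Longrightarrow> rev_poly n (rev_poly n p) = p"
  by (rule poly_eqI) (auto simp: coeff_rev_poly coeff_eq_0)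

lemma rev_poly_0 [simp]: "rev_poly n 0 = 0"
  by (rule poly_eqI) (simp add: coeff_rev_poly)

lemma rev_poly_add: "rev_poly n (p + q) = rev_poly n p + rev_poly n q"
  by (rule poly_eqI) (simp add: coeff_rev_poly)

lemma rev_poly_smult: "rev_poly n (smult c p) = smult c (rev_poly n p)"
  by (rule poly_eqI) (simp add: coeff_rev_poly)

lemma rev_poly_sum: "rev_poly n (\<Sum>i\<in>I. p i) = (\<Sum>i\<in>I. rev_poly n (p i))"
  by (induction I rule: infinite_finite_induct) (simp_all add: rev_poly_add)

lemma rev_poly_eq_reflect:
  assumes "degree p \<le> n"
  shows "rev_poly n p = monom 1 (n - degree p) * reflect_poly p"
  using assms by (intro poly_eqI) (auto simp: coeff_rev_poly coeff_monom_mult coeff_reflect_poly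
      intro!: coeff_eq_0 arg_cong[of _ _ "coeff p"])

lemma rev_poly_mult:
  assumes "degree p \<le> m" "degree q \<le> n"
  shows "rev_poly (m + n) (p * q) = rev_poly m p * rev_poly n q"
proof (cases "p = 0 \<or> q = 0")
  case False
  then have "degree (p * q) = degree p + degree q" by (simp add: degree_mult_eq)
  then have "monom (1::'a) (m + n - degree (p * q)) = monom 1 (m - degree p) * monom 1 (n - degree q)"
    using assms by (simp add: mult_monom)
  moreover have "degree (p * q) \<le> m + n" using assms degree_mult_le[of p q] by linarith
  ultimately show ?thesis
    using assms by (simp add: rev_poly_eq_reflect reflect_poly_mult mult_ac)
qed auto

definition rev_vec :: "nat \<Rightarrow> 'a::field poly ^ 'n \<Rightarrow> 'a poly ^ 'n" where
  "rev_vec n v = (\<chi> i. rev_poly n (v $ i))"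

lemma rev_vec_nth [simp]: "rev_vec n v $ i = rev_poly n (v $ i)"
  by (simp add: rev_vec_def)

lemma chart1_eq_rev_vec: "chart1 f = rev_vec 5 f"
  by (simp add: chart1_def rev_vec_def rev_poly_def)

lemma rev_poly_dot:
  fixes G v :: "'a::field poly ^ 'n"
  assumes "\<forall>i. degree (G $ i) \<le> m" "\<forall>i. degree (v $ i) \<le> n"
  shows "rev_poly (m + n) (dot G v) = dot (rev_vec m G) (rev_vec n v)"
  using assms by (simp add: dot_def rev_poly_sum rev_poly_mult)

lemma rev_vec_scale:
  fixes v :: "'a::field poly ^ 'n"
  assumes "degree c \<le> m" "\<forall>i. degree (v $ i) \<le> n"
  shows "rev_vec (m + n) (c *s v) = rev_poly m c *s rev_vec n v"
  using assms by (simp add: vec_eq_iff rev_poly_mult)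

lemma rev_vec_add: "rev_vec n (v + w) = rev_vec n v + rev_vec n w"
  by (simp add: vec_eq_iff rev_poly_add)

lemma rev_vec_rev_vec:
  fixes v :: "'a::field poly ^ 'n"
  shows "\<forall>i. degree (v $ i) \<le> n \<Longrightarrow> rev_vec n (rev_vec n v) = v"
  by (simp add: vec_eq_iff rev_poly_rev_poly)

lemma to_fract_eq_sum:
  fixes p :: "'a::field poly"
  assumes "degree p \<le> n"
  shows "to_fract p = (\<Sum>j\<le>n. to_fract [:coeff p j:] * rat_var ^ j)"
proof -
  have "to_fract p = to_fract (\<Sum>j\<le>n. monom (coeff p j) j)"
    using assms by (simp add: poly_as_sum_of_monoms')
  also have "\<dots> = (\<Sum>j\<le>n. to_fract (monom (coeff p j) j))"
    by (induction n) simp_all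
  also have "\<dots> = (\<Sum>j\<le>n. to_fract [:coeff p j:] * rat_var ^ j)"
  proof (intro sum.cong refl)
    fix j
    have "monom (coeff p j) j = [:coeff p j:] * [:0, 1:] ^ j"
      by (simp add: monom_altdef)
    moreover have "to_fract ([:0, 1:] ^ j) = (rat_var ^ j :: 'a poly fract)"
      by (induction j) (simp_all add: rat_var_def del: mult_pCons_left)
    ultimately show "to_fract (monom (coeff p j) j) = to_fract [:coeff p j:] * rat_var ^ j"
      by (simp only: to_fract_mult)
  qed
  finally show ?thesis .
qed

lemma rat_var_nz [simp]: "rat_var \<noteq> (0 :: 'a::field poly fract)"
  by (simp add: rat_var_def)

lemma rat_var_rev_poly:
  fixes p :: "'a::field poly"
  assumes "degree p \<le> n"
  shows "rat_var ^ n * poly (map_poly (\<lambda>c. to_fract [:c:]) (rev_poly n p)) (inverse rat_var)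
    = to_fract p"
proof -
  let ?h = "\<lambda>c::'a. to_fract [:c:]"
  have "degree (map_poly ?h (rev_poly n p)) \<le> n"
    using map_poly_degree_leq[of ?h "rev_poly n p"] degree_rev_poly[of n p] by linarith
  then have "map_poly ?h (rev_poly n p) = (\<Sum>i\<le>n. monom (?h (coeff p (n - i))) i)"
    by (subst poly_as_sum_of_monoms'[symmetric, of _ n])
      (auto simp: coeff_map_poly coeff_rev_poly intro!: sum.cong)
  then have "rat_var ^ n * poly (map_poly ?h (rev_poly n p)) (inverse rat_var)
    = (\<Sum>i\<le>n. ?h (coeff p (n - i)) * (rat_var ^ n * inverse rat_var ^ i))"
    by (simp add: poly_sum poly_monom sum_distrib_left mult_ac)
  also have "\<dots> = (\<Sum>i\<le>n. ?h (coeff p (n - i)) * rat_var ^ (n - i))"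
    by (intro sum.cong) (auto simp: power_diff divide_inverse power_inverse)
  also have "\<dots> = (\<Sum>i\<le>n. ?h (coeff p i) * rat_var ^ i)"
    by (rule sum.reindex_bij_witness[of _ "\<lambda>i. n - i" "\<lambda>i. n - i"]) auto
  also have "\<dots> = to_fract p" using to_fract_eq_sum[OF assms] by simp
  finally show ?thesis .
qed

text \<open>
  A vector of forms of degree \<open>n\<close> is a section of \<open>\<O>(n)\<close>; regarded as map \<open>\<O>(d - n) \<rightarrow> \<O>(d)\<close> it accounts
  for the exponent \<open>d - n\<close> in the gluing condition.
\<close>
lemma from_chart1_rev_vec:
  fixes v :: "'a::field poly ^ 'n"
  assumes "\<forall>i. degree (v $ i) \<le> n" "n \<le> d"
  shows "from_chart1 d (rev_vec n v) = rat_var ^ (d - n) *s from_chart0 v"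
proof -
  have d: "rat_var ^ d = rat_var ^ (d - n) * (rat_var ^ n :: 'a poly fract)"
    using assms(2) by (simp add: power_add[symmetric])
  show ?thesis
    using assms(1) unfolding from_chart1_def from_chart0_def d
    by (simp add: vec_eq_iff mult.assoc rat_var_rev_poly)
qed

lemma dot_axis: "dot G (axis k p) = G $ k * p"
  by (simp add: dot_def axis_def if_distrib[of "\<lambda>x. _ * x"] cong: if_cong)

section \<open>Bases of a quotient of a rank 4 module\<close>

lemma from_chart0_add: "from_chart0 (v + w) = from_chart0 v + from_chart0 w"
  by (simp add: from_chart0_def vec_eq_iff)

lemma from_chart0_scale: "from_chart0 (c *s v) = to_fract c *s from_chart0 v"
  by (simp add: from_chart0_def vec_eq_iff)

text \<open>
  Over the field of fractions the kernel of \<open>G\<close> has dimension 4: together with the unit vector at \<open>k\<close>, any set of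
  generators spans the whole space of dimension 5. Four generators are therefore independent.
\<close>
lemma independent_generators:
  fixes G :: "'a::field poly ^ 5"
  assumes G: "G $ k \<noteq> 0"
    and gen: "\<And>v. dot G v = 0 \<Longrightarrow> \<exists>a b c d. v = a *s y + b *s e + c *s g + d *s h"
    and rel: "a *s y + b *s e + c *s g + d *s h = 0"
  shows "a = 0 \<and> b = 0 \<and> c = 0 \<and> d = 0"
proof -
  define Y E' U W where "Y = from_chart0 y" and "E' = from_chart0 e" and "U = from_chart0 g" and "W = from_chart0 h"
  define S where "S = {axis k 1, Y, E', U, W}"
  have ax: "axis j 1 \<in> vec.span S" for j
  proof (cases "j = k")
    case False
    define u where "u = axis j (G $ k) - axis k (G $ j)"
    have "dot G u = 0"
      unfolding u_def dot_diff dot_axis by (simp add: mult.commute)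
    then obtain a b c d where u: "u = a *s y + b *s e + c *s g + d *s h" using gen by blast
    have "from_chart0 u = to_fract a *s Y + to_fract b *s E' + to_fract c *s U + to_fract d *s W"
      unfolding u by (simp add: from_chart0_add from_chart0_scale Y_def E'_def U_def W_def)
    also have "\<dots> \<in> vec.span S"
      by (intro vec.span_add vec.span_scale vec.span_base) (auto simp: S_def)
    finally have 1: "from_chart0 u \<in> vec.span S" .
    have "axis j 1 = inverse (to_fract (G $ k)) *s (from_chart0 u + to_fract (G $ j) *s axis k 1)"
      using G False by (auto simp: u_def from_chart0_def vec_eq_iff axis_def)
    also have "\<dots> \<in> vec.span S"
      using 1 by (intro vec.span_scale vec.span_add) (auto simp: S_def intro: vec.span_base)
    finally show ?thesis .
  qed (auto simp: S_def intro: vec.span_base)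
  have "cart_basis \<subseteq> vec.span S"
    using ax by (auto simp: cart_basis_def)
  then have full: "UNIV \<subseteq> vec.span S"
    by (metis span_cart_basis vec.span_minimal vec.subspace_span)
  have dim: "vec.dim (UNIV :: ('a poly fract ^ 5) set) = 5"
    unfolding vec_dim_card by simp
  have finS: "finite S" by (simp add: S_def)
  have "5 \<le> card S"
    using vec.span_card_ge_dim[OF subset_UNIV full finS] unfolding dim .
  then have card: "card S = 5"
    using card_insert_le_m1[of 5 "{Y, E', U, W}"] unfolding S_def
    by (simp add: card_insert_if split: if_splits)
  then have dist: "distinct [axis k 1, Y, E', U, W]"
    unfolding S_def by (simp add: card_insert_if split: if_splits)
  have "vec.independent S"
    using vec.card_le_dim_spanning[OF subset_UNIV full finS] card unfolding dim by simp
  then have ind: "(\<Sum>v\<in>S. u v *s v) = 0 \<Longrightarrow> v \<in> S \<Longrightarrow> u v = 0" for u v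
    using vec.dependent_finite[of S] by (auto simp: S_def)
  define u where "u = (\<lambda>v. if v = Y then to_fract a else if v = E' then to_fract b
     else if v = U then to_fract c else if v = W then to_fract d else 0)"
  have "(\<Sum>v\<in>S. u v *s v) = to_fract a *s Y + to_fract b *s E' + to_fract c *s U + to_fract d *s W"
  proof -
    have ne: "Y \<noteq> axis k 1" "E' \<noteq> axis k 1" "U \<noteq> axis k 1" "W \<noteq> axis k 1"
      "E' \<noteq> Y" "U \<noteq> Y" "W \<noteq> Y" "U \<noteq> E'" "W \<noteq> E'" "W \<noteq> U"
      using dist by auto
    have "u (axis k 1) = 0" "u Y = to_fract a" "u E' = to_fract b" "u U = to_fract c" "u W = to_fract d"
      using ne by (auto simp: u_def)
    moreover have "(\<Sum>v\<in>S. u v *s v) =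
      u (axis k 1) *s axis k 1 + (u Y *s Y + (u E' *s E' + (u U *s U + u W *s W)))"
      unfolding S_def using ne ne[symmetric] by simp
    ultimately show ?thesis by (simp add: add.assoc)
  qed
  also have "\<dots> = from_chart0 (a *s y + b *s e + c *s g + d *s h)"
    by (simp add: from_chart0_add from_chart0_scale Y_def E'_def U_def W_def)
  also have "\<dots> = 0" unfolding rel by (simp add: from_chart0_def vec_eq_iff)
  finally have "u v = 0" if "v \<in> S" for v using ind that by blast
  then have "u Y = 0" "u E' = 0" "u U = 0" "u W = 0" by (auto simp: S_def)
  then show ?thesis using dist by (auto simp: u_def)
qed

lemma quotient_basis_pair:
  fixes G :: "'a::field poly ^ 5"
  assumes G: "G $ k \<noteq> 0"
    and y: "dot G y = 0" and e: "dot G e = 0"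
    and gen: "\<And>v. dot G v = 0 \<Longrightarrow> \<exists>a b c d. v = a *s y + b *s e + c *s g + d *s pderiv_vec g"
  shows "quotient_basis {v. dot G v = 0} (cone_tangent g) [y, e]"
  unfolding quotient_basis_def
proof (intro conjI ballI)
  show "set [y, e] \<subseteq> {v. dot G v = 0}" using y e by simp
  fix x assume "x \<in> {v. dot G v = 0}"
  then obtain a b c d where x: "x = a *s y + b *s e + c *s g + d *s pderiv_vec g"
    using gen[of x] by auto
  show "\<exists>!cs. length cs = length [y, e] \<and>
      x - (\<Sum>j<length [y, e]. cs ! j *s [y, e] ! j) \<in> cone_tangent g"
  proof (rule ex1I[of _ "[a, b]"])
    show "length [a, b] = length [y, e] \<and> x - (\<Sum>j<length [y, e]. [a, b] ! j *s [y, e] ! j) \<in> cone_tangent g"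
    proof -
      have "x - (\<Sum>j<length [y, e]. [a, b] ! j *s [y, e] ! j) = c *s g + d *s pderiv_vec g"
        unfolding x by (simp add: lessThan_Suc)
      then show ?thesis unfolding cone_tangent_def by auto
    qed
  next
    fix cs
    assume cs: "length cs = length [y, e] \<and> x - (\<Sum>j<length [y, e]. cs ! j *s [y, e] ! j) \<in> cone_tangent g"
    then obtain a' b' where ab: "cs = [a', b']"
      by (auto simp: length_Suc_conv)
    then obtain c' d' where "x - (a' *s y + b' *s e) = c' *s g + d' *s pderiv_vec g"
      using cs by (auto simp: cone_tangent_def lessThan_Suc add.commute)
    then have "(a - a') *s y + (b - b') *s e + (c - c') *s g + (d - d') *s pderiv_vec g = 0"
      unfolding x by (simp add: vec_eq_iff algebra_simps)
    from independent_generators[OF G gen this] show "cs = [a, b]" using ab by simp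
  qed
qed

section \<open>The splitting type of the normal bundle\<close>

text \<open>
  The partial derivative in \<open>s\<close> of the homogeneous forms, on chart 0, where the one in \<open>t\<close> is
  \<^term>\<open>pderiv_vec f\<close>. By Euler's relation it is \<open>5 f - t f'\<close>.
\<close>
definition partial_s :: "'a::field poly ^ 5 \<Rightarrow> 'a poly ^ 5" where
  "partial_s f = [:5:] *s f - [:0, 1:] *s pderiv_vec f"

lemma coeff_partial_s: "coeff (partial_s f $ i) k = (5 - of_nat k) * coeff (f $ i) k"
  by (cases k) (simp_all add: partial_s_def pderiv_vec_def coeff_pderiv algebra_simps)

text \<open>
  The vector \<open>G\<close> stands for the gradient of a quartic along the curve; that the quartic contains the
  curve gives the relations with \<open>f\<close> and \<open>f'\<close>, by Euler's formula and the chain rule. Forms of degree \<open>n\<close> are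
  encoded as polynomials of degree at most \<open>n\<close>.
\<close>
locale quintic_gradient =
  fixes f G :: "'a::field poly ^ 5"
  assumes five: "(5::'a) \<noteq> 0"
    and deg_f: "\<And>i. degree (f $ i) \<le> 5" and deg_G: "\<And>i. degree (G $ i) \<le> 15"
    and Gf: "dot G f = 0" and Gf': "dot G (pderiv_vec f) = 0"
    and cubics: "\<And>q. degree q \<le> 18 \<Longrightarrow> \<exists>w. (\<forall>i. degree (w $ i) \<le> 3) \<and> dot G w = q"
    and imm0: "immersive f" and imm1: "immersive (chart1 f)"
begin

definition relations :: "nat \<Rightarrow> ('a poly ^ 5) set" where
  "relations n = {v. (\<forall>i. degree (v $ i) \<le> n) \<and> dot G v = 0}"

lemma deg_pderiv_vec: "degree (pderiv_vec f $ i) \<le> 4"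
proof (rule degree_le, intro allI impI)
  fix k :: nat assume "4 < k"
  then have "coeff (f $ i) (Suc k) = 0"
    using deg_f[of i] by (intro coeff_eq_0) simp
  then show "coeff (pderiv_vec f $ i) k = 0"
    by (simp add: pderiv_vec_def coeff_pderiv)
qed

lemma deg_partial_s: "degree (partial_s f $ i) \<le> 4"
proof (rule degree_le, intro allI impI)
  fix k :: nat assume k: "4 < k"
  show "coeff (partial_s f $ i) k = 0"
  proof (cases "k = 5")
    case False
    then have "coeff (f $ i) k = 0"
      using deg_f[of i] k by (intro coeff_eq_0) simp
    then show ?thesis by (simp add: coeff_partial_s)
  qed (simp add: coeff_partial_s)
qed

lemma dot_partial_s: "dot G (partial_s f) = 0"
  by (simp add: partial_s_def dot_diff dot_scale Gf Gf')

text \<open>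
  The leading term of \<open>q\<close> is \<open>t\<close> times a monomial that is reached in degree \<open>n\<close>.
\<close>
lemma cubics_higher:
  assumes "3 \<le> n" "degree q \<le> 15 + n"
  shows "\<exists>w. (\<forall>i. degree (w $ i) \<le> n) \<and> dot G w = q"
  using assms
proof (induction n arbitrary: q rule: dec_induct)
  case base
  then show ?case using cubics[of q] by simp
next
  case (step n)
  define c where "c = coeff q (15 + Suc n)"
  have "degree (monom c (15 + n)) \<le> 15 + n" by (rule degree_monom_le)
  then obtain w1 where w1: "\<forall>i. degree (w1 $ i) \<le> n" "dot G w1 = monom c (15 + n)"
    using step.IH by blast
  have "degree (q - monom c (15 + Suc n)) \<le> 15 + n"
  proof (rule degree_le, intro allI impI)
    fix k assume "15 + n < k"
    then show "coeff (q - monom c (15 + Suc n)) k = 0"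
      using step.prems by (cases "k = 15 + Suc n") (auto simp: c_def intro!: coeff_eq_0)
  qed
  then obtain w2 where w2: "\<forall>i. degree (w2 $ i) \<le> n" "dot G w2 = q - monom c (15 + Suc n)"
    using step.IH by blast
  have "dot G ([:0, 1:] *s w1 + w2) = q"
    using monom_Suc[of c "15 + n"] by (simp add: dot_add dot_scale w1 w2)
  moreover have "degree (([:0, 1:] *s w1 + w2) $ i) \<le> Suc n" for i
  proof -
    have "degree ([:0, 1:] * w1 $ i) \<le> Suc n"
      using w1(1) by (cases "w1 $ i = 0") auto
    moreover have "degree (w2 $ i) \<le> Suc n" using w2(1) le_SucI by blast
    ultimately show ?thesis by (simp add: degree_add_le)
  qed
  ultimately show ?case by blast
qed

text \<open>
  Any \<open>v\<close> is \<open>a + t b\<close> with \<open>a, b\<close> of degree \<open>n\<close>. Since \<open>G a = - t G b\<close>, the polynomial \<open>c = - G b\<close> has degree at most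
  \<open>n + 14\<close>, so \<open>c = G w\<close> for some \<open>w\<close> of degree \<open>n - 1\<close> by the spanning condition, and
  \<open>a - t w\<close> and \<open>b + w\<close> are relations.
\<close>
lemma relations_split:
  assumes n: "4 \<le> n" and v: "v \<in> relations (Suc n)"
  shows "\<exists>a\<in>relations n. \<exists>b\<in>relations n. v = a + [:0, 1:] *s b"
proof -
  define b where "b = (\<chi> i. monom (coeff (v $ i) (Suc n)) n)"
  define a where "a = v - [:0, 1:] *s b"
  have deg_v: "degree (v $ i) \<le> Suc n" for i using v by (simp add: relations_def)
  have deg_b: "degree (b $ i) \<le> n" for i by (simp add: b_def degree_monom_le)
  have deg_a: "degree (a $ i) \<le> n" for i
  proof (rule degree_le, intro allI impI)
    fix k assume k: "n < k"
    have "a $ i = v $ i - monom (coeff (v $ i) (Suc n)) (Suc n)"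
      by (simp add: a_def b_def monom_Suc)
    then show "coeff (a $ i) k = 0"
      using k deg_v[of i] by (cases "k = Suc n") (auto intro!: coeff_eq_0)
  qed
  define c where "c = - dot G b"
  have Ga: "dot G a = [:0, 1:] * c"
    using v by (simp add: a_def c_def dot_diff dot_scale relations_def)
  have "degree c \<le> 15 + (n - 1)"
  proof (cases "c = 0")
    case False
    then have "degree ([:0, 1:] * c) = Suc (degree c)" by simp
    moreover have "degree (dot G a) \<le> 15 + n" by (rule degree_dot_le[OF deg_G deg_a])
    ultimately show ?thesis using Ga n by simp
  qed simp
  then obtain w where w: "\<forall>i. degree (w $ i) \<le> n - 1" "dot G w = c"
  proof -
    have "3 \<le> n - 1" using n by simp
    then show ?thesis using cubics_higher[OF _ \<open>degree c \<le> 15 + (n - 1)\<close>] that by blast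
  qed
  have deg_tw: "degree ([:0, 1:] * w $ i) \<le> n" for i
  proof -
    have "degree (w $ i) \<le> n - 1" using w(1) by blast
    then show ?thesis using n by (cases "w $ i = 0") auto
  qed
  have "a - [:0, 1:] *s w \<in> relations n"
    using deg_a deg_tw Ga w(2) by (auto simp: relations_def dot_diff dot_scale intro: degree_diff_le)
  moreover have "b + w \<in> relations n"
    using deg_b w by (auto simp: relations_def dot_add c_def intro!: degree_add_le intro: order_trans)
  moreover have "v = (a - [:0, 1:] *s w) + [:0, 1:] *s (b + w)"
    by (simp add: a_def vec_eq_iff algebra_simps)
  ultimately show ?thesis by blast
qed

text \<open>
  The relations of degree 3 are a space of dimension \<open>20 - 19\<close>. A vector
  of cubic forms is a map from \<open>\<O>(2)\<close> to \<open>\<O>(5)\<^sup>5\<close>, which explains the name.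
\<close>
lemma generator_degree_2:
  obtains y where "y \<noteq> 0" "y \<in> relations 3"
proof -
  obtain B where B: "finite B" "poly_vec_space.independent B"
    "poly_vec_space.span B = relations 3" "card B + Suc (15 + 3) = CARD(5) * Suc 3"
    using kernel_dot_basis[OF deg_G, of 3] cubics unfolding relations_def by auto
  then have "B \<noteq> {}" by auto
  then obtain y where y: "y \<in> B" by blast
  have "y \<noteq> 0" using B(2) y poly_vec_space.dependent_zero by blast
  moreover have "y \<in> relations 3" using y B(3) poly_vec_space.span_base by blast
  ultimately show ?thesis by (rule that)
qed

text \<open>
  At a zero of the linear form \<open>\<gamma> s + \<delta> t\<close>, a point of the projective line, the relation becomes one
  between the two partial derivatives of \<open>f\<close>, which are independent there because the curve is immersed. The
  case distinction is whether the point at infinity is the only zero.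
\<close>
lemma linear_relations_trivial:
  assumes y: "y \<noteq> 0" "y \<in> relations 3"
    and rel: "[:\<alpha>:] *s partial_s f + [:\<beta>:] *s pderiv_vec f + [:\<gamma>, \<delta>:] *s y = 0"
  shows "\<alpha> = 0 \<and> \<beta> = 0 \<and> \<gamma> = 0 \<and> \<delta> = 0"
proof -
  have rel_i: "smult \<alpha> (partial_s f $ i) + smult \<beta> (pderiv (f $ i)) + [:\<gamma>, \<delta>:] * y $ i = 0" for i
    using rel by (simp add: vec_eq_iff pderiv_vec_def)
  have "\<alpha> = 0 \<and> \<beta> = 0"
  proof (cases "\<delta> = 0 \<and> \<gamma> \<noteq> 0")
    case True
    have "5 * \<beta> * coeff (f $ i) 5 + \<alpha> * coeff (f $ i) 4 = 0" for i
    proof -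
      have "coeff (y $ i) 4 = 0"
        using y(2) by (intro coeff_eq_0) (auto simp: relations_def intro: le_less_trans)
      moreover have "coeff (smult \<alpha> (partial_s f $ i) + smult \<beta> (pderiv (f $ i)) + [:\<gamma>, \<delta>:] * y $ i) 4 = 0"
        unfolding rel_i by simp
      ultimately show ?thesis
        using True by (simp add: coeff_partial_s coeff_pderiv algebra_simps)
    qed
    then have "(5 * \<beta>) *s poly_vec (chart1 f) 0 + \<alpha> *s poly_vec (pderiv_vec (chart1 f)) 0 = 0"
      by (simp add: vec_eq_iff poly_vec_def pderiv_vec_def chart1_eq_rev_vec poly_0_coeff_0
          coeff_rev_poly coeff_pderiv)
    then show ?thesis using imm1 five unfolding immersive_def by (metis mult_eq_0_iff)
  next
    case False
    then have "\<gamma> + (if \<delta> = 0 then 0 else - \<gamma> / \<delta>) * \<delta> = 0" by simp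
    then obtain a where a: "\<gamma> + a * \<delta> = 0" by blast
    have "5 * \<alpha> * poly (f $ i) a + (\<beta> - \<alpha> * a) * poly (pderiv (f $ i)) a = 0" for i
    proof -
      have "5 * \<alpha> * poly (f $ i) a + (\<beta> - \<alpha> * a) * poly (pderiv (f $ i)) a
          + (\<gamma> + a * \<delta>) * poly (y $ i) a
        = poly (smult \<alpha> (partial_s f $ i) + smult \<beta> (pderiv (f $ i)) + [:\<gamma>, \<delta>:] * y $ i) a"
        by (simp add: partial_s_def pderiv_vec_def algebra_simps)
      also have "\<dots> = 0" unfolding rel_i by simp
      finally show ?thesis using a by simp
    qed
    then have "(5 * \<alpha>) *s poly_vec f a + (\<beta> - \<alpha> * a) *s poly_vec (pderiv_vec f) a = 0"
      by (simp add: vec_eq_iff poly_vec_def pderiv_vec_def)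
    then have "5 * \<alpha> = 0 \<and> \<beta> - \<alpha> * a = 0" using imm0 unfolding immersive_def by blast
    then show ?thesis using five by auto
  qed
  moreover from this have "[:\<gamma>, \<delta>:] * y $ i = 0" for i using rel_i[of i] by simp
  moreover obtain i where "y $ i \<noteq> 0" using y(1) by (auto simp: vec_eq_iff)
  ultimately show ?thesis by (metis mult_eq_0_iff pCons_eq_0_iff)
qed

text \<open>
  The relations of degree 4, maps from \<open>\<O>(1)\<close> to \<open>\<O>(5)\<^sup>5\<close>, are a space of dimension
  \<open>25 - 20 = 5\<close>, in which \<open>y\<close>, \<open>t y\<close> and the two
  partial derivatives of \<open>f\<close> are independent.
\<close>
lemma generator_degree_1:
  assumes y: "y \<noteq> 0" "y \<in> relations 3"
  obtains e where "e \<in> relations 4"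
    "\<And>v. v \<in> relations 4 \<Longrightarrow> \<exists>\<alpha> \<beta> \<gamma> \<delta> \<epsilon>. v =
       [:\<gamma>, \<delta>:] *s y + [:\<epsilon>:] *s e + [:\<alpha>:] *s partial_s f + [:\<beta>:] *s pderiv_vec f"
proof -
  define ty where "ty = [:0, 1:] *s y"
  obtain B where B: "finite B" "poly_vec_space.independent B"
    "poly_vec_space.span B = relations 4" "card B + Suc (15 + 4) = CARD(5) * Suc 4"
    using kernel_dot_basis[OF deg_G, of 4] cubics_higher[of 4] unfolding relations_def by auto
  have triv: "\<alpha> = 0 \<and> \<beta> = 0 \<and> \<gamma> = 0 \<and> \<delta> = 0"
    if "[:\<alpha>:] *s partial_s f + [:\<beta>:] *s pderiv_vec f + [:\<gamma>:] *s y + [:\<delta>:] *s ty = 0" for \<alpha> \<beta> \<gamma> \<delta>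
  proof (rule linear_relations_trivial[OF y])
    have "[:\<gamma>, \<delta>:] *s y = [:\<gamma>:] *s y + [:\<delta>:] *s ty"
      by (simp add: ty_def vec_eq_iff smult_add_right algebra_simps)
    then show "[:\<alpha>:] *s partial_s f + [:\<beta>:] *s pderiv_vec f + [:\<gamma>, \<delta>:] *s y = 0"
      using that by (simp add: add.assoc)
  qed
  let ?sp = "poly_vec_space.span :: ('a poly ^ 5) set \<Rightarrow> _"
  have sp1: "\<exists>a. v = [:a:] *s w" if "v \<in> ?sp {w}" for v w
    using that by (auto simp: poly_vec_space.span_singleton)
  have sp2: "\<exists>a. v - [:a:] *s w \<in> ?sp S" if "v \<in> ?sp (insert w S)" for v w S
    using that by (simp add: poly_vec_space.span_breakdown_eq)
  have 0: "ty \<noteq> 0"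
    using triv[of 0 0 0 1] by auto
  have 1: "y \<notin> ?sp {ty}"
  proof
    assume "y \<in> ?sp {ty}"
    then obtain a where "y = [:a:] *s ty" using sp1 by blast
    then have "[:0:] *s partial_s f + [:0:] *s pderiv_vec f + [:1:] *s y + [:-a:] *s ty = 0"
      by (simp add: vec_eq_iff)
    from triv[OF this] show False by simp
  qed
  have 2: "pderiv_vec f \<notin> ?sp {y, ty}"
  proof
    assume "pderiv_vec f \<in> ?sp {y, ty}"
    then obtain a b where "pderiv_vec f - [:a:] *s y = [:b:] *s ty"
      using sp1 by (blast dest: sp2)
    then have "[:0:] *s partial_s f + [:1:] *s pderiv_vec f + [:-a:] *s y + [:-b:] *s ty = 0"
      by (simp add: vec_eq_iff algebra_simps)
    from triv[OF this] show False by simp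
  qed
  have 3: "partial_s f \<notin> ?sp {pderiv_vec f, y, ty}"
  proof
    assume "partial_s f \<in> ?sp {pderiv_vec f, y, ty}"
    then obtain a where "partial_s f - [:a:] *s pderiv_vec f \<in> ?sp {y, ty}" by (blast dest: sp2)
    then obtain b c where "partial_s f - [:a:] *s pderiv_vec f - [:b:] *s y = [:c:] *s ty"
      using sp1 by (blast dest: sp2)
    then have "[:1:] *s partial_s f + [:-a:] *s pderiv_vec f + [:-b:] *s y + [:-c:] *s ty = 0"
      by (simp add: vec_eq_iff algebra_simps)
    from triv[OF this] show False by simp
  qed
  define I where "I = {partial_s f, pderiv_vec f, y, ty}"
  have ind: "poly_vec_space.independent I"
    unfolding I_def
    using 0 by (intro poly_vec_space.independent_insertI[OF 3] poly_vec_space.independent_insertI[OF 2]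
        poly_vec_space.independent_insertI[OF 1]) (simp add: poly_vec_space.dependent_single)
  have cardI: "card I = 4"
  proof -
    have out: "v \<notin> S" if "v \<notin> ?sp S" for v S
      using that poly_vec_space.span_base[of v S] by argo
    show ?thesis using out[OF 1] out[OF 2] out[OF 3] unfolding I_def by simp
  qed
  have "ty \<in> relations 4"
    using y(2) by (auto simp: relations_def ty_def dot_scale)
  then have I: "I \<subseteq> relations 4"
    using y(2) by (auto simp: I_def relations_def deg_partial_s deg_pderiv_vec Gf' dot_partial_s
        intro: order_trans)
  obtain C where C: "I \<subseteq> C" "C \<subseteq> relations 4" "poly_vec_space.independent C"
    "relations 4 \<subseteq> ?sp C"
    by (rule poly_vec_space.maximal_independent_subset_extend[OF I ind])
  have spC: "?sp C = relations 4"
    using C B(3) by (metis poly_vec_space.span_minimal poly_vec_space.subspace_span subset_antisym)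
  have finC: "finite C"
    using poly_vec_space.independent_span_bound[OF B(1) C(3)] C(2) B(3) by simp
  have "card C = card B"
    using poly_vec_space.dim_eq_card[of C C] poly_vec_space.dim_eq_card[of B C] C(3) B(2,3) spC by simp
  then have "card (C - I) = 1"
    using B(4) cardI C(1) finC by (simp add: card_Diff_subset finite_subset)
  then obtain e where e: "C - I = {e}" by (rule card_1_singletonE)
  then have Ce: "C = insert e I" using C(1) by blast
  show ?thesis
  proof (rule that[of e])
    show "e \<in> relations 4" using C(2) Ce by blast
    fix v assume "v \<in> relations 4"
    then have "v \<in> ?sp (insert e I)" using spC Ce by simp
    then obtain \<epsilon> where "v - [:\<epsilon>:] *s e \<in> ?sp {partial_s f, pderiv_vec f, y, ty}"
      unfolding I_def by (blast dest: sp2)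
    then obtain \<alpha> where "v - [:\<epsilon>:] *s e - [:\<alpha>:] *s partial_s f \<in> ?sp {pderiv_vec f, y, ty}"
      by (blast dest: sp2)
    then obtain \<beta> where "v - [:\<epsilon>:] *s e - [:\<alpha>:] *s partial_s f - [:\<beta>:] *s pderiv_vec f \<in> ?sp {y, ty}"
      by (blast dest: sp2)
    then obtain \<gamma> \<delta> where
      "v - [:\<epsilon>:] *s e - [:\<alpha>:] *s partial_s f - [:\<beta>:] *s pderiv_vec f - [:\<gamma>:] *s y = [:\<delta>:] *s ty"
      using sp1 by (blast dest: sp2)
    then have "v = [:\<gamma>, \<delta>:] *s y + [:\<epsilon>:] *s e + [:\<alpha>:] *s partial_s f + [:\<beta>:] *s pderiv_vec f"
      by (simp add: vec_eq_iff ty_def algebra_simps smult_add_right)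
    then show "\<exists>\<alpha> \<beta> \<gamma> \<delta> \<epsilon>. v =
       [:\<gamma>, \<delta>:] *s y + [:\<epsilon>:] *s e + [:\<alpha>:] *s partial_s f + [:\<beta>:] *s pderiv_vec f"
      by blast
  qed
qed

text \<open>
  The bounds on the degrees say that the coefficients are forms, so that the statement can be read on either chart.
\<close>
lemma relations_generated:
  assumes e: "\<And>v. v \<in> relations 4 \<Longrightarrow> \<exists>\<alpha> \<beta> \<gamma> \<delta> \<epsilon>. v =
       [:\<gamma>, \<delta>:] *s y + [:\<epsilon>:] *s e + [:\<alpha>:] *s partial_s f + [:\<beta>:] *s pderiv_vec f"
    and "4 \<le> n" "v \<in> relations n"
  shows "\<exists>a b c d. degree a \<le> n - 3 \<and> degree b \<le> n - 4 \<and> degree c \<le> n - 4 \<and> degree d \<le> n - 4 \<and>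
     v = a *s y + b *s e + c *s partial_s f + d *s pderiv_vec f"
  using assms(2,3)
proof (induction n arbitrary: v rule: dec_induct)
  case base
  obtain \<alpha> \<beta> \<gamma> \<delta> \<epsilon> where
    "v = [:\<gamma>, \<delta>:] *s y + [:\<epsilon>:] *s e + [:\<alpha>:] *s partial_s f + [:\<beta>:] *s pderiv_vec f"
    using e[OF base] by blast
  then show ?case
    by (intro exI[of _ "[:\<gamma>, \<delta>:]"] exI[of _ "[:\<epsilon>:]"] exI[of _ "[:\<alpha>:]"] exI[of _ "[:\<beta>:]"]) simp
next
  case (step n)
  obtain v1 v2 where v12: "v1 \<in> relations n" "v2 \<in> relations n" "v = v1 + [:0, 1:] *s v2"
    using relations_split[OF _ step.prems] step.hyps by auto
  obtain a b c d where 1: "degree a \<le> n - 3" "degree b \<le> n - 4" "degree c \<le> n - 4" "degree d \<le> n - 4"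
     "v1 = a *s y + b *s e + c *s partial_s f + d *s pderiv_vec f"
    using step.IH[OF v12(1)] by blast
  obtain a' b' c' d' where 2: "degree a' \<le> n - 3" "degree b' \<le> n - 4" "degree c' \<le> n - 4" "degree d' \<le> n - 4"
     "v2 = a' *s y + b' *s e + c' *s partial_s f + d' *s pderiv_vec f"
    using step.IH[OF v12(2)] by blast
  have deg: "degree (p + [:0, 1:] * q) \<le> Suc m" if "degree p \<le> m" "degree q \<le> m" for p q :: "'a poly" and m
    using that by (intro degree_add_le) (auto simp: degree_pCons_eq_if)
  have "v = (a + [:0, 1:] * a') *s y + (b + [:0, 1:] * b') *s e +
      (c + [:0, 1:] * c') *s partial_s f + (d + [:0, 1:] * d') *s pderiv_vec f"
    unfolding v12(3) 1(5) 2(5) by (simp add: vec_eq_iff algebra_simps)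
  moreover have "Suc n - 3 = Suc (n - 3)" "Suc n - 4 = Suc (n - 4)" using step.hyps by auto
  ultimately show ?case
    using deg[OF 1(1) 2(1)] deg[OF 1(2) 2(2)] deg[OF 1(3) 2(3)] deg[OF 1(4) 2(4)]
    by (intro exI conjI; (assumption | simp only:))
qed

text \<open>
  Reversal exchanges \<open>s\<close> and \<open>t\<close>, hence the two partial derivatives.
\<close>
lemma rev_partial_s: "rev_vec 4 (partial_s f) = pderiv_vec (chart1 f)"
proof -
  have "coeff (rev_poly 4 (partial_s f $ i)) k = coeff (pderiv (rev_poly 5 (f $ i))) k" for i k
  proof (cases "k \<le> 4")
    case True
    then have "k \<in> {0, 1, 2, 3, 4}" by auto
    then show ?thesis
      by (auto simp: coeff_rev_poly coeff_partial_s coeff_pderiv)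
  qed (simp add: coeff_rev_poly coeff_pderiv)
  then show ?thesis
    by (simp add: vec_eq_iff poly_eq_iff chart1_eq_rev_vec pderiv_vec_def)
qed

lemma rev_pderiv_vec: "rev_vec 4 (pderiv_vec f) = partial_s (chart1 f)"
proof -
  have "coeff (rev_poly 4 (pderiv (f $ i))) k = coeff (partial_s (chart1 f) $ i) k" for i k
  proof (cases "k \<le> 5")
    case True
    then have "k \<in> {0, 1, 2, 3, 4, 5}" by auto
    then show ?thesis
      by (auto simp: coeff_rev_poly coeff_partial_s coeff_pderiv chart1_eq_rev_vec eval_nat_numeral)
  qed (simp add: coeff_rev_poly coeff_partial_s chart1_eq_rev_vec)
  then show ?thesis
    by (simp add: vec_eq_iff poly_eq_iff pderiv_vec_def)
qed

text \<open>
  The relations \<open>y\<close> and \<open>e\<close> of degrees 3 and 4 give the isomorphism with \<open>\<O>(2) \<oplus> \<O>(1)\<close>. That they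
  generate the quotient over chart 1 follows from the graded statement \<open>relations_generated\<close>, as
  reversal preserves the degrees there.
\<close>
lemma balanced_subquotient:
  "balanced \<lparr> twist = 5, num0 = {v. dot G v = 0}, den0 = cone_tangent f,
     num1 = {v. dot (rev_vec 15 G) v = 0}, den1 = cone_tangent (chart1 f) \<rparr>"
proof -
  obtain y where y: "y \<noteq> 0" "y \<in> relations 3" by (rule generator_degree_2)
  obtain e where e: "e \<in> relations 4"
    and e4: "\<And>v. v \<in> relations 4 \<Longrightarrow> \<exists>\<alpha> \<beta> \<gamma> \<delta> \<epsilon>. v =
       [:\<gamma>, \<delta>:] *s y + [:\<epsilon>:] *s e + [:\<alpha>:] *s partial_s f + [:\<beta>:] *s pderiv_vec f"
    using generator_degree_1[OF y] by blast
  have gen: "\<exists>a b c d. degree a \<le> n - 3 \<and> degree b \<le> n - 4 \<and> degree c \<le> n - 4 \<and> degree d \<le> n - 4 \<and>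
     v = a *s y + b *s e + c *s partial_s f + d *s pderiv_vec f" if "4 \<le> n" "v \<in> relations n" for n v
    using e4 that by (rule relations_generated)
  have dy: "\<forall>i. degree (y $ i) \<le> 3" "dot G y = 0" and de: "\<forall>i. degree (e $ i) \<le> 4" "dot G e = 0"
    using y(2) e by (auto simp: relations_def)
  have dG: "\<forall>i. degree (G $ i) \<le> 15" using deg_G by simp
  obtain k where k: "G $ k \<noteq> 0"
  proof -
    obtain w where "dot G w = 1" using cubics[of 1] by auto
    then have "\<not> (\<forall>k. G $ k = 0)" unfolding dot_def by force
    then show ?thesis using that by blast
  qed
  have k1: "rev_vec 15 G $ k \<noteq> 0"
    using k rev_poly_rev_poly[of "G $ k" 15] deg_G by auto
  have bound: "\<exists>n\<ge>4. \<forall>i. degree (v $ i) \<le> n" for v :: "'a poly ^ 5"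
  proof (intro exI conjI allI)
    show "4 \<le> 4 + (\<Sum>i\<in>UNIV. degree (v $ i))" by simp
    show "degree (v $ i) \<le> 4 + (\<Sum>i\<in>UNIV. degree (v $ i))" for i
      using member_le_sum[of i UNIV "\<lambda>i. degree (v $ i)"] by simp
  qed
  have 0: "quotient_basis {v. dot G v = 0} (cone_tangent f) [y, e]"
  proof (rule quotient_basis_pair[OF k dy(2) de(2)])
    fix v assume v: "dot G v = 0"
    obtain n where n: "4 \<le> n" "\<forall>i. degree (v $ i) \<le> n" using bound by blast
    obtain a b c d where "v = a *s y + b *s e + c *s partial_s f + d *s pderiv_vec f"
      using gen[OF n(1), of v] n(2) v unfolding relations_def by blast
    then have "v = a *s y + b *s e + (c * [:5:]) *s f + (d - c * [:0, 1:]) *s pderiv_vec f"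
      by (simp add: partial_s_def vec_eq_iff algebra_simps)
    then show "\<exists>a b c d. v = a *s y + b *s e + c *s f + d *s pderiv_vec f" by blast
  qed
  have dy1: "dot (rev_vec 15 G) (rev_vec 3 y) = 0"
    using rev_poly_dot[OF dG dy(1)] dy(2) by simp
  have de1: "dot (rev_vec 15 G) (rev_vec 4 e) = 0"
    using rev_poly_dot[OF dG de(1)] de(2) by simp
  have 1: "quotient_basis {v. dot (rev_vec 15 G) v = 0} (cone_tangent (chart1 f)) [rev_vec 3 y, rev_vec 4 e]"
  proof (rule quotient_basis_pair[OF k1 dy1 de1])
    fix v assume v: "dot (rev_vec 15 G) v = 0"
    obtain n where n: "4 \<le> n" "\<forall>i. degree (v $ i) \<le> n" using bound by blast
    have dr: "\<forall>i. degree (rev_vec 15 G $ i) \<le> 15" by (simp add: degree_rev_poly)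
    have "dot G (rev_vec n v) = 0"
      using rev_poly_dot[OF dr n(2)] v by (simp add: rev_vec_rev_vec[OF dG])
    then have "rev_vec n v \<in> relations n" by (simp add: relations_def degree_rev_poly)
    then obtain a b c d where deg: "degree a \<le> n - 3" "degree b \<le> n - 4" "degree c \<le> n - 4" "degree d \<le> n - 4"
      and eq: "rev_vec n v = a *s y + b *s e + c *s partial_s f + d *s pderiv_vec f"
      using gen[OF n(1)] by blast
    have "v = rev_vec n (a *s y + b *s e + c *s partial_s f + d *s pderiv_vec f)"
      unfolding eq[symmetric] using rev_vec_rev_vec[OF n(2)] by simp
    also have "\<dots> = rev_vec (n - 3 + 3) (a *s y) + rev_vec (n - 4 + 4) (b *s e)
        + rev_vec (n - 4 + 4) (c *s partial_s f) + rev_vec (n - 4 + 4) (d *s pderiv_vec f)"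
      using n(1) by (simp add: rev_vec_add)
    also have "\<dots> = rev_poly (n - 3) a *s rev_vec 3 y + rev_poly (n - 4) b *s rev_vec 4 e
        + rev_poly (n - 4) c *s pderiv_vec (chart1 f) + rev_poly (n - 4) d *s partial_s (chart1 f)"
      using deg dy(1) de(1) deg_partial_s deg_pderiv_vec
      by (simp only: rev_vec_scale rev_partial_s rev_pderiv_vec simp_thms)
    also have "\<dots> = rev_poly (n - 3) a *s rev_vec 3 y + rev_poly (n - 4) b *s rev_vec 4 e
        + (rev_poly (n - 4) d * [:5:]) *s chart1 f
        + (rev_poly (n - 4) c - rev_poly (n - 4) d * [:0, 1:]) *s pderiv_vec (chart1 f)"
      by (simp add: partial_s_def vec_eq_iff algebra_simps)
    finally show "\<exists>a b c d. v = a *s rev_vec 3 y + b *s rev_vec 4 e + c *s chart1 f + d *s pderiv_vec (chart1 f)"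
      by blast
  qed
  have zero: "0 \<in> on_overlap (cone_tangent f)"
  proof -
    have "(0 :: 'a poly ^ 5) = 0 *s f + 0 *s pderiv_vec f" by (simp add: vec_eq_iff)
    then have "0 \<in> cone_tangent f" unfolding cone_tangent_def by blast
    moreover have "rat_var ^ 0 *s 0 = from_chart0 (0 :: 'a poly ^ 5)"
      by (simp add: from_chart0_def vec_eq_iff)
    ultimately show ?thesis unfolding on_overlap_def by blast
  qed
  have glue: "from_chart1 5 ([rev_vec 3 y, rev_vec 4 e] ! j) - rat_var powi ([2, 1] ! j) *s from_chart0 ([y, e] ! j)
        \<in> on_overlap (cone_tangent f)" if "j < 2" for j
  proof -
    have "from_chart1 5 (rev_vec 3 y) - rat_var powi 2 *s from_chart0 y = 0"
      using from_chart1_rev_vec[OF dy(1), of 5] by simp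
    moreover have "from_chart1 5 (rev_vec 4 e) - rat_var powi 1 *s from_chart0 e = 0"
      using from_chart1_rev_vec[OF de(1), of 5] by simp
    moreover have "j = 0 \<or> j = 1" using that by auto
    ultimately show ?thesis using zero by auto
  qed
  have "iso_sum_of_line_bundles \<lparr> twist = 5, num0 = {v. dot G v = 0}, den0 = cone_tangent f,
     num1 = {v. dot (rev_vec 15 G) v = 0}, den1 = cone_tangent (chart1 f) \<rparr> [2, 1]"
    unfolding iso_sum_of_line_bundles_def subquotient.select_convs
    by (intro exI[of _ "[y, e]"] exI[of _ "[rev_vec 3 y, rev_vec 4 e]"] conjI 0 1 allI impI glue) simp_all
  then show ?thesis unfolding balanced_def by (intro exI[of _ "[2, 1]"]) auto
qed

end

section \<open>Quartics and their gradients along a curve\<close>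

text \<open>
  The exponents of monomials are differences with \<^term>\<open>Poly_Mapping.single i (1::nat)\<close>, which should
  not be rewritten to \<^term>\<open>Suc 0\<close>.
\<close>
declare One_nat_def [simp del]

definition gradient :: "('n::finite, 'a::field) mpoly \<Rightarrow> 'a poly ^ 'n \<Rightarrow> 'a poly ^ 'n" where
  "gradient F g = (\<chi> i. mpoly_eval (\<lambda>c. [:c:]) (mpoly_pderiv i F) (($) g))"

text \<open>
  The value at \<open>x\<close> of the partial derivative of the monomial with exponents \<open>m\<close>.
\<close>
definition eval_pderiv_monom :: "'v \<Rightarrow> ('v \<Rightarrow> 'b) \<Rightarrow> ('v \<Rightarrow>\<^sub>0 nat) \<Rightarrow> 'b::comm_ring_1" where
  "eval_pderiv_monom i x m = of_nat (Poly_Mapping.lookup m i) * eval_monom x (m - Poly_Mapping.single i 1)"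

lemma mpoly_eval_pderiv:
  assumes h: "h 0 = 0" "\<And>a b. h (a + b) = h a + h b" "\<And>n a. h (of_nat n * a) = of_nat n * h a"
  shows "mpoly_eval h (mpoly_pderiv i F) x =
    (\<Sum>m\<in>Poly_Mapping.keys F. h (Poly_Mapping.lookup F m) * eval_pderiv_monom i x m)"
  unfolding mpoly_pderiv_def mpoly_eval_sum[OF h(1,2)] mpoly_eval_single[of h, OF h(1)] h(3) eval_pderiv_monom_def
  by (simp add: mult_ac)

lemma mpoly_eval_pderiv_id:
  "mpoly_eval id (mpoly_pderiv i F) x =
    (\<Sum>m\<in>Poly_Mapping.keys F. Poly_Mapping.lookup F m * eval_pderiv_monom i x m)"
  by (subst mpoly_eval_pderiv) simp_all

lemma of_nat_mult_const_poly: "[:of_nat n * (a::'a::comm_ring_1):] = of_nat n * [:a:]"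
  by (simp add: of_nat_poly)

lemma gradient_nth:
  "gradient F g $ i =
    (\<Sum>m\<in>Poly_Mapping.keys F. smult (Poly_Mapping.lookup F m) (eval_pderiv_monom i (($) g) m))"
  unfolding gradient_def
  by (simp add: mpoly_eval_pderiv of_nat_mult_const_poly)

lemma mpoly_eval_const_poly:
  "mpoly_eval (\<lambda>c. [:c:]) F x =
    (\<Sum>m\<in>Poly_Mapping.keys F. smult (Poly_Mapping.lookup F m) (eval_monom x m))"
  by (simp add: mpoly_eval_def eval_monom_def)

lemma eval_monom_eq_prod_UNIV: "eval_monom x m = (\<Prod>i\<in>UNIV. x i ^ Poly_Mapping.lookup m i)"
  for m :: "'v::finite \<Rightarrow>\<^sub>0 nat"
  by (rule eval_monom_superset) auto

lemma lookup_diff_single: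
  "Poly_Mapping.lookup (m - Poly_Mapping.single i 1) j =
     (if j = i then Poly_Mapping.lookup m i - 1 else Poly_Mapping.lookup m j)"
  by (simp add: lookup_minus lookup_single when_def)

lemma eval_monom_diff_single:
  fixes m :: "'v::finite \<Rightarrow>\<^sub>0 nat"
  shows "eval_monom x (m - Poly_Mapping.single i 1) =
    x i ^ (Poly_Mapping.lookup m i - 1) * (\<Prod>j\<in>UNIV - {i}. x j ^ Poly_Mapping.lookup m j)"
proof -
  have "eval_monom x (m - Poly_Mapping.single i 1) =
      x i ^ (Poly_Mapping.lookup m i - 1) *
      (\<Prod>j\<in>UNIV - {i}. x j ^ Poly_Mapping.lookup (m - Poly_Mapping.single i 1) j)"
    unfolding eval_monom_eq_prod_UNIV by (subst prod.remove[of _ i]) (simp_all add: lookup_diff_single)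
  also have "(\<Prod>j\<in>UNIV - {i}. x j ^ Poly_Mapping.lookup (m - Poly_Mapping.single i 1) j) =
      (\<Prod>j\<in>UNIV - {i}. x j ^ Poly_Mapping.lookup m j)"
    by (intro prod.cong) (auto simp: lookup_diff_single)
  finally show ?thesis .
qed

lemma eval_pderiv_monom_mult:
  fixes m :: "'v::finite \<Rightarrow>\<^sub>0 nat"
  shows "eval_pderiv_monom i x m * x i = of_nat (Poly_Mapping.lookup m i) * eval_monom x m"
proof (cases "Poly_Mapping.lookup m i = 0")
  case False
  then have "x i ^ Poly_Mapping.lookup m i = x i * x i ^ (Poly_Mapping.lookup m i - 1)"
    by (cases "Poly_Mapping.lookup m i") simp_all
  moreover have "eval_monom x m =
      x i ^ Poly_Mapping.lookup m i * (\<Prod>j\<in>UNIV - {i}. x j ^ Poly_Mapping.lookup m j)"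
    unfolding eval_monom_eq_prod_UNIV by (subst prod.remove[of _ i]) simp_all
  ultimately show ?thesis
    by (simp add: eval_pderiv_monom_def eval_monom_diff_single mult_ac)
qed (simp add: eval_pderiv_monom_def)

lemma pderiv_eval_monom:
  fixes m :: "'v::finite \<Rightarrow>\<^sub>0 nat" and x :: "'v \<Rightarrow> 'a::field poly"
  shows "pderiv (eval_monom x m) = (\<Sum>i\<in>UNIV. eval_pderiv_monom i x m * pderiv (x i))"
  unfolding eval_monom_eq_prod_UNIV pderiv_prod
proof (intro sum.cong refl)
  fix i
  show "(\<Prod>j\<in>UNIV - {i}. x j ^ Poly_Mapping.lookup m j) * pderiv (x i ^ Poly_Mapping.lookup m i) =
      eval_pderiv_monom i x m * pderiv (x i)"
    by (simp add: eval_pderiv_monom_def eval_monom_diff_single pderiv_power of_nat_poly mult_ac)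
qed

lemma euler_relation:
  assumes F: "homogeneous 4 F"
  shows "dot (gradient F g) g = 4 * mpoly_eval (\<lambda>c. [:c:]) F (($) g)"
proof -
  have "dot (gradient F g) g = (\<Sum>i\<in>UNIV. \<Sum>m\<in>Poly_Mapping.keys F.
      smult (Poly_Mapping.lookup F m) (of_nat (Poly_Mapping.lookup m i) * eval_monom (($) g) m))"
    by (simp add: dot_def gradient_nth sum_distrib_right eval_pderiv_monom_mult)
  also have "\<dots> = (\<Sum>m\<in>Poly_Mapping.keys F. \<Sum>i\<in>UNIV.
      smult (Poly_Mapping.lookup F m) (of_nat (Poly_Mapping.lookup m i) * eval_monom (($) g) m))"
    by (rule sum.swap)
  also have "\<dots> = (\<Sum>m\<in>Poly_Mapping.keys F. 4 * smult (Poly_Mapping.lookup F m) (eval_monom (($) g) m))"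
  proof (intro sum.cong refl)
    fix m assume "m \<in> Poly_Mapping.keys F"
    then have 4: "(\<Sum>i\<in>UNIV. Poly_Mapping.lookup m i) = 4"
      using F by (simp add: homogeneous_def)
    have "(\<Sum>i\<in>UNIV. smult (Poly_Mapping.lookup F m) (of_nat (Poly_Mapping.lookup m i) * eval_monom (($) g) m))
        = of_nat (\<Sum>i\<in>UNIV. Poly_Mapping.lookup m i) * smult (Poly_Mapping.lookup F m) (eval_monom (($) g) m)"
      by (simp add: sum_distrib_right poly_space.scale_sum_right)
    then show "(\<Sum>i\<in>UNIV. smult (Poly_Mapping.lookup F m) (of_nat (Poly_Mapping.lookup m i) * eval_monom (($) g) m))
        = 4 * smult (Poly_Mapping.lookup F m) (eval_monom (($) g) m)"
      by (simp add: 4)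
  qed
  also have "\<dots> = 4 * mpoly_eval (\<lambda>c. [:c:]) F (($) g)"
    by (simp add: mpoly_eval_const_poly sum_distrib_left)
  finally show ?thesis .
qed

lemma chain_rule:
  "dot (gradient F g) (pderiv_vec g) = pderiv (mpoly_eval (\<lambda>c. [:c:]) F (($) g))"
proof -
  have "dot (gradient F g) (pderiv_vec g) = (\<Sum>i\<in>UNIV. \<Sum>m\<in>Poly_Mapping.keys F.
      smult (Poly_Mapping.lookup F m) (eval_pderiv_monom i (($) g) m * pderiv (g $ i)))"
    by (simp add: dot_def gradient_nth sum_distrib_right pderiv_vec_def)
  also have "\<dots> = (\<Sum>m\<in>Poly_Mapping.keys F. \<Sum>i\<in>UNIV.
      smult (Poly_Mapping.lookup F m) (eval_pderiv_monom i (($) g) m * pderiv (g $ i)))"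
    by (rule sum.swap)
  also have "\<dots> = pderiv (mpoly_eval (\<lambda>c. [:c:]) F (($) g))"
    by (simp add: mpoly_eval_const_poly pderiv_sum pderiv_smult pderiv_eval_monom poly_space.scale_sum_right)
  finally show ?thesis .
qed

lemma degree_and_rev_prod_power:
  fixes p :: "'i \<Rightarrow> 'a::field poly"
  assumes "finite I" "\<And>i. i \<in> I \<Longrightarrow> degree (p i) \<le> d"
  shows "degree (\<Prod>i\<in>I. p i ^ k i) \<le> d * (\<Sum>i\<in>I. k i) \<and>
    rev_poly (d * (\<Sum>i\<in>I. k i)) (\<Prod>i\<in>I. p i ^ k i) = (\<Prod>i\<in>I. rev_poly d (p i) ^ k i)"
proof -
  have one: "rev_poly 0 1 = (1 :: 'a poly)"
    by (rule poly_eqI) (auto simp: coeff_rev_poly)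
  have pw: "degree (q ^ n) \<le> d * n \<and> rev_poly (d * n) (q ^ n) = rev_poly d q ^ n"
    if q: "degree q \<le> d" for q :: "'a poly" and n
  proof (induction n)
    case (Suc n)
    have "degree (q * q ^ n) \<le> d + d * n"
      using degree_mult_le[of q "q ^ n"] q Suc by linarith
    moreover have "rev_poly (d + d * n) (q * q ^ n) = rev_poly d q * rev_poly d q ^ n"
      using rev_poly_mult[OF q] Suc by simp
    ultimately show ?case by simp
  qed (simp add: one)
  show ?thesis using assms
  proof (induction I rule: finite_induct)
    case (insert i I)
    let ?P = "\<Prod>i\<in>I. p i ^ k i"
    have IH: "degree ?P \<le> d * (\<Sum>i\<in>I. k i)"
      "rev_poly (d * (\<Sum>i\<in>I. k i)) ?P = (\<Prod>i\<in>I. rev_poly d (p i) ^ k i)"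
      using insert by auto
    have pi: "degree (p i ^ k i) \<le> d * k i" "rev_poly (d * k i) (p i ^ k i) = rev_poly d (p i) ^ k i"
      using pw insert.prems by auto
    have "degree (p i ^ k i * ?P) \<le> d * k i + d * (\<Sum>i\<in>I. k i)"
      using degree_mult_le[of "p i ^ k i" ?P] pi(1) IH(1) by linarith
    then show ?case
      using rev_poly_mult[OF pi(1) IH(1)] insert.hyps by (simp add: pi IH distrib_left)
  qed (simp add: one)
qed

lemma degree_eval_monom_le:
  fixes f :: "'a::field poly ^ 5"
  assumes "f \<in> quintic_tuples"
  shows "degree (eval_monom (($) f) m) \<le> 5 * (\<Sum>i\<in>UNIV. Poly_Mapping.lookup m i)"
  using degree_and_rev_prod_power[of UNIV "($) f" 5] assms
  by (simp add: eval_monom_eq_prod_UNIV quintic_tuples_def)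

lemma eval_monom_chart1:
  fixes f :: "'a::field poly ^ 5"
  assumes "f \<in> quintic_tuples"
  shows "eval_monom (($) (chart1 f)) m = rev_poly (5 * (\<Sum>i\<in>UNIV. Poly_Mapping.lookup m i)) (eval_monom (($) f) m)"
  using degree_and_rev_prod_power[of UNIV "($) f" 5] assms
  by (simp add: eval_monom_eq_prod_UNIV quintic_tuples_def chart1_eq_rev_vec)

lemma sum_lookup_diff_single:
  fixes m :: "'v::finite \<Rightarrow>\<^sub>0 nat"
  assumes "Poly_Mapping.lookup m i \<noteq> 0"
  shows "(\<Sum>j\<in>UNIV. Poly_Mapping.lookup (m - Poly_Mapping.single i 1) j) =
     (\<Sum>j\<in>UNIV. Poly_Mapping.lookup m j) - 1"
proof -
  have "(\<Sum>j\<in>UNIV - {i}. Poly_Mapping.lookup (m - Poly_Mapping.single i 1) j) =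
      (\<Sum>j\<in>UNIV - {i}. Poly_Mapping.lookup m j)"
    by (intro sum.cong) (auto simp: lookup_diff_single)
  then show ?thesis
    using assms sum.remove[of UNIV i "Poly_Mapping.lookup m"]
      sum.remove[of UNIV i "Poly_Mapping.lookup (m - Poly_Mapping.single i 1)"]
    by (simp add: lookup_diff_single)
qed

lemma eval_pderiv_monom_bounds:
  fixes f :: "'a::field poly ^ 5"
  assumes f: "f \<in> quintic_tuples" and m: "(\<Sum>i\<in>UNIV. Poly_Mapping.lookup m i) = 4"
  shows "degree (eval_pderiv_monom i (($) f) m) \<le> 15"
    and "eval_pderiv_monom i (($) (chart1 f)) m = rev_poly 15 (eval_pderiv_monom i (($) f) m)"
proof -
  have "degree (eval_pderiv_monom i (($) f) m) \<le> 15 \<and>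
    eval_pderiv_monom i (($) (chart1 f)) m = rev_poly 15 (eval_pderiv_monom i (($) f) m)"
  proof (cases "Poly_Mapping.lookup m i = 0")
    case False
    let ?m = "m - Poly_Mapping.single i 1"
    have 3: "(\<Sum>j\<in>UNIV. Poly_Mapping.lookup ?m j) = 3"
      using sum_lookup_diff_single[OF False] m by simp
    have "degree (eval_monom (($) f) ?m) \<le> 15" using degree_eval_monom_le[OF f, of ?m] unfolding 3 by simp
    moreover have "eval_monom (($) (chart1 f)) ?m = rev_poly 15 (eval_monom (($) f) ?m)"
      using eval_monom_chart1[OF f, of ?m] unfolding 3 by simp
    ultimately show ?thesis
      by (simp add: eval_pderiv_monom_def of_nat_poly rev_poly_smult order_trans[OF degree_smult_le])
  qed (simp add: eval_pderiv_monom_def)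
  then show "degree (eval_pderiv_monom i (($) f) m) \<le> 15"
    and "eval_pderiv_monom i (($) (chart1 f)) m = rev_poly 15 (eval_pderiv_monom i (($) f) m)" by auto
qed

lemma gradient_bounds:
  fixes f :: "'a::field poly ^ 5"
  assumes f: "f \<in> quintic_tuples" and F: "homogeneous 4 F"
  shows "degree (gradient F f $ i) \<le> 15"
    and "gradient F (chart1 f) = rev_vec 15 (gradient F f)"
    and "mpoly_eval (\<lambda>c. [:c:]) F (($) (chart1 f)) = rev_poly 20 (mpoly_eval (\<lambda>c. [:c:]) F (($) f))"
proof -
  have m: "(\<Sum>i\<in>UNIV. Poly_Mapping.lookup m i) = 4" if "m \<in> Poly_Mapping.keys F" for m
    using F that by (simp add: homogeneous_def)
  show "degree (gradient F f $ i) \<le> 15"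
    unfolding gradient_nth using eval_pderiv_monom_bounds(1)[OF f m]
    by (intro degree_sum_le) (auto intro: order_trans[OF degree_smult_le])
  show "gradient F (chart1 f) = rev_vec 15 (gradient F f)"
    by (simp add: vec_eq_iff gradient_nth rev_poly_sum rev_poly_smult eval_pderiv_monom_bounds(2)[OF f m])
  show "mpoly_eval (\<lambda>c. [:c:]) F (($) (chart1 f)) = rev_poly 20 (mpoly_eval (\<lambda>c. [:c:]) F (($) f))"
    by (simp add: mpoly_eval_const_poly rev_poly_sum rev_poly_smult eval_monom_chart1[OF f] m)
qed

lemma poly_eval_monom: "poly (eval_monom x m) a = eval_monom (\<lambda>i. poly (x i) a) m"
  for x :: "'v \<Rightarrow> 'a::comm_ring_1 poly"
  by (simp add: eval_monom_def poly_prod)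

lemma nth_poly_vec: "($) (poly_vec g a) = (\<lambda>i. poly (g $ i) a)"
  by (auto simp: poly_vec_def)

lemma poly_mpoly_eval:
  "poly (mpoly_eval (\<lambda>c. [:c:]) F (($) g)) a = mpoly_eval id F (($) (poly_vec g a))"
  by (simp add: mpoly_eval_const_poly mpoly_eval_def eval_monom_def[symmetric] poly_sum poly_eval_monom nth_poly_vec)

lemma poly_gradient:
  "poly (gradient F g $ i) a = mpoly_eval id (mpoly_pderiv i F) (($) (poly_vec g a))"
  by (simp add: gradient_nth mpoly_eval_pderiv_id eval_pderiv_monom_def poly_sum poly_eval_monom nth_poly_vec
      of_nat_poly mult.assoc)

lemma eval_monom_scale:
  fixes m :: "'v::finite \<Rightarrow>\<^sub>0 nat"
  shows "eval_monom (\<lambda>i. c * x i) m = c ^ (\<Sum>i\<in>UNIV. Poly_Mapping.lookup m i) * eval_monom x m"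
  by (simp add: eval_monom_eq_prod_UNIV power_mult_distrib prod.distrib power_sum)

lemma mpoly_eval_scale:
  fixes F :: "('n::finite, 'a::field) mpoly"
  assumes F: "homogeneous 4 F"
  shows "mpoly_eval id F (($) (c *s v)) = c ^ 4 * mpoly_eval id F (($) v)"
    and "mpoly_eval id (mpoly_pderiv i F) (($) (c *s v)) = c ^ 3 * mpoly_eval id (mpoly_pderiv i F) (($) v)"
proof -
  have m: "(\<Sum>i\<in>UNIV. Poly_Mapping.lookup m i) = 4" if "m \<in> Poly_Mapping.keys F" for m
    using F that by (simp add: homogeneous_def)
  have v: "($) (c *s v) = (\<lambda>i. c * v $ i)" by auto
  show "mpoly_eval id F (($) (c *s v)) = c ^ 4 * mpoly_eval id F (($) v)"
    unfolding v by (simp add: mpoly_eval_def eval_monom_def[symmetric] eval_monom_scale m sum_distrib_left mult_ac)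
  have "eval_pderiv_monom i (\<lambda>i. c * v $ i) m = c ^ 3 * eval_pderiv_monom i (($) v) m"
    if "m \<in> Poly_Mapping.keys F" for m
  proof (cases "Poly_Mapping.lookup m i = 0")
    case False
    have "(\<Sum>j\<in>UNIV. Poly_Mapping.lookup (m - Poly_Mapping.single i 1) j) = 3"
      using sum_lookup_diff_single[OF False] m[OF that] by simp
    then show ?thesis
      using eval_monom_scale[of c "($) v" "m - Poly_Mapping.single i 1"] by (simp add: eval_pderiv_monom_def mult_ac)
  qed (simp add: eval_pderiv_monom_def)
  then show "mpoly_eval id (mpoly_pderiv i F) (($) (c *s v)) = c ^ 3 * mpoly_eval id (mpoly_pderiv i F) (($) v)"
    unfolding v by (simp add: mpoly_eval_pderiv_id sum_distrib_left mult_ac)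
qed

text \<open>
  The remaining point \<open>s = 0\<close> is the origin of chart 1.
\<close>
lemma curve_point_on_chart:
  fixes f :: "'a::field poly ^ 5"
  assumes f: "f \<in> quintic_tuples" and st: "(s, t) \<noteq> (0, 0)"
  obtains c a where "c \<noteq> 0" "curve_point f s t = c *s poly_vec f a"
    | c where "c \<noteq> 0" "curve_point f s t = c *s poly_vec (chart1 f) 0"
proof (cases "s = 0")
  case False
  have deg: "degree (f $ i) \<le> 5" for i using f by (simp add: quintic_tuples_def)
  have "(\<Sum>j\<le>5. coeff (f $ i) j * s ^ (5 - j) * t ^ j) = s ^ 5 * poly (f $ i) (t / s)" for i
    unfolding poly_eq_sum_upto[OF deg] sum_distrib_left
  proof (intro sum.cong refl)
    fix j :: nat assume "j \<in> {..5}"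
    then have "s ^ 5 = s ^ (5 - j) * s ^ j" by (simp add: power_add[symmetric])
    then show "coeff (f $ i) j * s ^ (5 - j) * t ^ j = s ^ 5 * (coeff (f $ i) j * (t / s) ^ j)"
      using False by (simp add: power_divide)
  qed
  then have "curve_point f s t = s ^ 5 *s poly_vec f (t / s)"
    by (simp add: vec_eq_iff curve_point_def poly_vec_def)
  then show ?thesis using that(1)[of "s ^ 5"] False by simp
next
  case True
  have "(\<Sum>j\<le>5. coeff (f $ i) j * s ^ (5 - j) * t ^ j) = t ^ 5 * coeff (f $ i) 5" for i
  proof -
    have "(\<Sum>j\<le>5. coeff (f $ i) j * s ^ (5 - j) * t ^ j) =
        (\<Sum>j\<le>(5::nat). if j = 5 then t ^ 5 * coeff (f $ i) 5 else 0)"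
      using True by (intro sum.cong) auto
    then show ?thesis by simp
  qed
  then have "curve_point f s t = t ^ 5 *s poly_vec (chart1 f) 0"
    by (simp add: vec_eq_iff curve_point_def poly_vec_def chart1_eq_rev_vec poly_0_coeff_0 coeff_rev_poly)
  then show ?thesis using that(2)[of "t ^ 5"] True st by simp
qed

text \<open>
  As 1 and \<open>t\<^sup>1\<^sup>8\<close> are among the forms that the cubic multiples of the components of the gradient
  span, these components have no common zero on chart 0 and none at infinity; so \<open>X\<close> is smooth
  along the curve.
\<close>
lemma quartic_with_spanning_gradient:
  fixes f :: "'a::field poly ^ 5"
  assumes five: "(5::'a) \<noteq> 0"
    and f: "f \<in> quintic_tuples" and smooth: "smooth_rational_quintic f"
    and F: "homogeneous 4 F" and Ff: "mpoly_eval (\<lambda>c. [:c:]) F (($) f) = 0"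
    and cubics: "\<And>q. degree q \<le> 18 \<Longrightarrow> \<exists>w. (\<forall>i. degree (w $ i) \<le> 3) \<and> dot (gradient F f) w = q"
  shows "quartic_form F \<and> hypersurface_contains F f \<and> smooth_along F f \<and> balanced (normal_bundle F f)"
proof -
  let ?G = "gradient F f"
  have dG: "\<forall>i. degree (?G $ i) \<le> 15" using gradient_bounds(1)[OF f F] by blast
  note G1 = gradient_bounds(2)[OF f F]
  interpret quintic_gradient f ?G
  proof
    show "dot ?G f = 0" using euler_relation[OF F, of f] Ff by simp
    show "dot ?G (pderiv_vec f) = 0" using chain_rule[of F f] Ff by simp
  qed (use five f smooth dG cubics in \<open>auto simp: quintic_tuples_def smooth_rational_quintic_def\<close>)
  have nz0: "\<exists>i. poly (?G $ i) a \<noteq> 0" for a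
  proof -
    obtain w where "dot ?G w = 1" using cubics[of 1] by auto
    then have "poly (dot ?G w) a = 1" by simp
    then have "(\<Sum>i\<in>UNIV. poly (?G $ i) a * poly (w $ i) a) = 1" by (simp add: dot_def poly_sum)
    then have "\<not> (\<forall>i. poly (?G $ i) a = 0)" by (intro notI) simp
    then show ?thesis by simp
  qed
  have nz1: "\<exists>i. poly (gradient F (chart1 f) $ i) 0 \<noteq> 0"
  proof -
    obtain w where w: "\<forall>i. degree (w $ i) \<le> 3" "dot ?G w = monom 1 18"
      using cubics[of "monom 1 18"] degree_monom_le[of "1::'a" 18] by blast
    have "dot (gradient F (chart1 f)) (rev_vec 3 w) = rev_poly 18 (monom 1 18)"
      using rev_poly_dot[OF dG w(1)] unfolding G1 w(2) by simp
    then have "poly (dot (gradient F (chart1 f)) (rev_vec 3 w)) 0 = 1"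
      by (simp add: poly_0_coeff_0 coeff_rev_poly)
    then have "(\<Sum>i\<in>UNIV. poly (gradient F (chart1 f) $ i) 0 * poly (rev_vec 3 w $ i) 0) = 1"
      by (simp add: dot_def poly_sum)
    then have "\<not> (\<forall>i. poly (gradient F (chart1 f) $ i) 0 = 0)" by (intro notI) simp
    then show ?thesis by simp
  qed
  have "F \<noteq> 0" using nz0[of 0] by (auto simp: gradient_nth)
  then have "quartic_form F" using F by (simp add: quartic_form_def)
  moreover have "hypersurface_contains F f"
    unfolding hypersurface_contains_def
  proof (intro allI impI)
    fix s t :: 'a assume "(s, t) \<noteq> (0, 0)"
    then show "mpoly_eval id F (($) (curve_point f s t)) = 0"
      by (rule curve_point_on_chart[OF f])
        (simp_all add: mpoly_eval_scale(1)[OF F] poly_mpoly_eval[symmetric] Ff gradient_bounds(3)[OF f F])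
  qed
  moreover have "smooth_along F f"
    unfolding smooth_along_def
  proof (intro allI impI)
    fix s t :: 'a assume "(s, t) \<noteq> (0, 0)"
    then show "\<exists>i. mpoly_eval id (mpoly_pderiv i F) (($) (curve_point f s t)) \<noteq> 0"
      by (rule curve_point_on_chart[OF f])
        (use nz0 nz1 in \<open>simp_all add: mpoly_eval_scale(2)[OF F] poly_gradient[symmetric]\<close>)
  qed
  moreover have "balanced (normal_bundle F f)"
  proof -
    have "kernel_dF F g = {v. dot (gradient F g) v = 0}" for g
      by (simp add: kernel_dF_def dot_def gradient_def)
    then have "normal_bundle F f = \<lparr> twist = 5, num0 = {v. dot ?G v = 0}, den0 = cone_tangent f,
       num1 = {v. dot (rev_vec 15 ?G) v = 0}, den1 = cone_tangent (chart1 f) \<rparr>"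
      by (simp add: normal_bundle_def G1)
    then show ?thesis using balanced_subquotient by simp
  qed
  ultimately show ?thesis by blast
qed

section \<open>A quartic through a monomial quintic\<close>

text \<open>
  The exponents of the monomial quintic are 0, 1, 2, 4, 5: already sums of two give all numbers up to 10.
\<close>
lemma two_parts: "k \<le> 10 \<Longrightarrow> \<exists>a\<in>{0, 1, 2, 4, 5::nat}. \<exists>b\<in>{0, 1, 2, 4, 5}. k = a + b"
proof -
  assume "k \<le> (10::nat)"
  then have "k \<in> {0, 1, 2, 3, 4, 5, 6, 7, 8, 9, 10}" unfolding insert_iff empty_iff by presburger
  then show ?thesis by (elim insertE) simp_all
qed

lemma four_parts:
  assumes "k \<le> 20"
  obtains a b c d where "{a, b, c, d} \<subseteq> {0, 1, 2, 4, 5::nat}" "k = a + b + c + d"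
proof -
  obtain a b where ab: "a \<in> {0, 1, 2, 4, 5}" "b \<in> {0, 1, 2, 4, 5}" "min k 10 = a + b"
    using two_parts[of "min k 10"] by (meson min.cobounded2)
  have "k - min k 10 \<le> 10" using assms by auto
  from two_parts[OF this]
  obtain c d where cd: "c \<in> {0, 1, 2, 4, 5}" "d \<in> {0, 1, 2, 4, 5}" "k - min k 10 = c + d"
    by meson
  have "k = a + b + c + d" using ab(3) cd(3) by linarith
  moreover have "{a, b, c, d} \<subseteq> {0, 1, 2, 4, 5}"
    by (intro insert_subsetI ab(1,2) cd(1,2) empty_subsetI)
  ultimately show ?thesis by (intro that[of a b c d])
qed

text \<open>
  The hypotheses list the products with \<open>t\<^sup>j\<close> of the components of the gradient of \<open>F\<^sub>0\<close> at \<open>f\<^sub>0\<close>. Most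
  monomials are obtained with integral coefficients; only \<open>t, t\<^sup>9, t\<^sup>1\<^sup>6\<close> come from
  three equations in these unknowns, whose determinant is 5.
\<close>
lemma spanning_set_monomials:
  fixes S :: "'a::field poly set"
  assumes five: "(5::'a) \<noteq> 0"
    and add: "\<And>p q. p \<in> S \<Longrightarrow> q \<in> S \<Longrightarrow> p + q \<in> S"
    and smult: "\<And>c p. p \<in> S \<Longrightarrow> smult c p \<in> S"
    and T: "T = (\<lambda>k. monom (1::'a) k)"
    and G0: "\<And>j. j \<le> 3 \<Longrightarrow> T (2 + j) \<in> S"
    and G1: "\<And>j. j \<le> 3 \<Longrightarrow> - 2 * T (1 + j) - T (9 + j) \<in> S"
    and G2: "\<And>j. j \<le> 3 \<Longrightarrow> T j + 2 * T (8 + j) - T (15 + j) \<in> S"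
    and G4: "\<And>j. j \<le> 3 \<Longrightarrow> - 2 * T (6 + j) + 3 * T (13 + j) \<in> S"
    and G5: "\<And>j. j \<le> 3 \<Longrightarrow> T (5 + j) - 2 * T (12 + j) \<in> S"
    and k: "k \<le> 18"
  shows "T k \<in> S"
proof -
  have uminus: "- p \<in> S" if "p \<in> S" for p using smult[OF that, of "-1"] by simp
  have diff: "p - q \<in> S" if "p \<in> S" "q \<in> S" for p q using add[OF that(1) uminus[OF that(2)]] by simp
  have num: "numeral n * p \<in> S" if "p \<in> S" for n p
    using smult[OF that, of "numeral n"] by (simp add: numeral_poly)
  have t2: "T 2 \<in> S" and t3: "T 3 \<in> S" and t4: "T 4 \<in> S" and t5: "T 5 \<in> S"
    using G0[of 0] G0[of 1] G0[of 2] G0[of 3] by simp_all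
  have double: "q \<in> S" if P: "p \<in> S" and Q: "- 2 * p - q \<in> S" for p q
  proof -
    have "- (- 2 * p - q) - 2 * p = q" by simp
    then show ?thesis using diff[OF uminus[OF Q] num[OF P, of "num.Bit0 num.One"]] by simp
  qed
  have t10: "T 10 \<in> S" by (rule double[OF t2]) (use G1[of 1] in simp)
  have t11: "T 11 \<in> S" by (rule double[OF t3]) (use G1[of 2] in simp)
  have t12: "T 12 \<in> S" by (rule double[OF t4]) (use G1[of 3] in simp)
  have pair: "p \<in> S \<and> q \<in> S" if P: "p - 2 * q \<in> S" and Q: "- 2 * p + 3 * q \<in> S" for p q
  proof -
    have "- (2 * (p - 2 * q) + (- 2 * p + 3 * q)) = q" by (simp add: algebra_simps)
    then have q: "q \<in> S" using uminus[OF add[OF num[OF P, of "num.Bit0 num.One"] Q]] by simp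
    have "(p - 2 * q) + 2 * q = p" by simp
    then show ?thesis using add[OF P num[OF q, of "num.Bit0 num.One"]] q by simp
  qed
  have t6: "T 6 \<in> S \<and> T 13 \<in> S" by (rule pair) (use G5[of 1] G4[of 0] in simp_all)
  have t7: "T 7 \<in> S \<and> T 14 \<in> S" by (rule pair) (use G5[of 2] G4[of 1] in simp_all)
  have t8: "T 8 \<in> S \<and> T 15 \<in> S" by (rule pair) (use G5[of 3] G4[of 2] in simp_all)
  have first: "p \<in> S" if "p + 2 * q - r \<in> S" "q \<in> S" "r \<in> S" for p q r
    using add[OF diff[OF that(1) num[OF that(2), of "num.Bit0 num.One"]] that(3)] by simp
  have last: "r \<in> S" if "p + 2 * q - r \<in> S" "p \<in> S" "q \<in> S" for p q r
    using diff[OF add[OF that(2) num[OF that(3), of "num.Bit0 num.One"]] that(1)] by simp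
  have t0: "T 0 \<in> S" by (rule first[of "T 0" "T 8" "T 15"]) (use G2[of 0] t8 in simp_all)
  have t17: "T 17 \<in> S" by (rule last[of "T 2" "T 10" "T 17"]) (use G2[of 2] t2 t10 in simp_all)
  have t18: "T 18 \<in> S" by (rule last[of "T 3" "T 11" "T 18"]) (use G2[of 3] t3 t11 in simp_all)
  have R1: "T 1 + 2 * T 9 - T 16 \<in> S" and R2: "- 2 * T 1 - T 9 \<in> S" and R3: "- 2 * T 9 + 3 * T 16 \<in> S"
    using G2[of 1] G1[of 0] G4[of 3] by simp_all
  have t1: "T 1 \<in> S"
  proof -
    (* 3, 4, 1 are, up to sign, the first row of 5 times the inverse of the matrix of the three equations. *)
    have "- (3 * (T 1 + 2 * T 9 - T 16) + 4 * (- 2 * T 1 - T 9) + (- 2 * T 9 + 3 * T 16)) \<in> S"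
      by (rule uminus[OF add[OF add[OF num[OF R1] num[OF R2]] R3]])
    also have "- (3 * (T 1 + 2 * T 9 - T 16) + 4 * (- 2 * T 1 - T 9) + (- 2 * T 9 + 3 * T 16)) = 5 * T 1"
      by (simp add: algebra_simps)
    finally have "smult (1 / 5) (5 * T 1) \<in> S" by (rule smult)
    moreover have "smult (1 / 5) (5 * T 1) = T 1" using five by (simp add: numeral_poly)
    ultimately show ?thesis by simp
  qed
  have t9: "T 9 \<in> S" by (rule double[OF t1 R2])
  have t16: "T 16 \<in> S" by (rule last[OF R1 t1 t9])
  have "k \<in> {0, 1, 2, 3, 4, 5, 6, 7, 8, 9, 10, 11, 12, 13, 14, 15, 16, 17, 18}" using k unfolding insert_iff empty_iff by presburger
  then show ?thesis
    using t0 t1 t2 t3 t4 t5 t6 t7 t8 t9 t10 t11 t12 t16 t17 t18 by (elim insertE) simp_all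
qed

text \<open>
  The derivative is determined by its product with \<open>t\<^sup>e\<close>, the value of the variable.
\<close>
lemma eval_pderiv_monom_monomial_quintic:
  assumes m: "eval_monom (($) (monomial_quintic ex :: 'a::field poly ^ 5)) m = monom 1 w" and i: "ex i = e"
  shows "eval_pderiv_monom i (($) (monomial_quintic ex :: 'a poly ^ 5)) m =
    (if e \<le> w then monom (of_nat (Poly_Mapping.lookup m i)) (w - e) else 0)"
proof (rule poly_eqI)
  fix n
  have f0i: "(monomial_quintic ex :: 'a poly ^ 5) $ i = monom 1 e"
    by (simp add: monomial_quintic_def i)
  have "eval_pderiv_monom i (($) (monomial_quintic ex :: 'a poly ^ 5)) m * monom 1 e =
      monom (of_nat (Poly_Mapping.lookup m i)) w"
    using eval_pderiv_monom_mult[of i "($) (monomial_quintic ex :: 'a poly ^ 5)" m]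
    unfolding m f0i by (simp add: of_nat_poly smult_monom)
  then have "coeff (eval_pderiv_monom i (($) (monomial_quintic ex :: 'a poly ^ 5)) m * monom 1 e) (n + e) =
      coeff (monom (of_nat (Poly_Mapping.lookup m i)) w) (n + e)" by simp
  then show "coeff (eval_pderiv_monom i (($) (monomial_quintic ex :: 'a poly ^ 5)) m) n =
      coeff (if e \<le> w then monom (of_nat (Poly_Mapping.lookup m i)) (w - e) else 0) n"
    by (auto simp: mult.commute[of _ "monom 1 e"] coeff_monom_mult)
qed

text \<open>
  The index type has five elements; \<open>ex\<close> labels them by the exponents 0, 1, 2, 4, 5, and \<open>var k\<close> is the
  index of the coordinate \<open>t\<^sup>k\<close>.
\<close>
locale special_quintic =
  fixes ex :: "5 \<Rightarrow> nat"
  assumes ex: "bij_betw ex UNIV {0, 1, 2, 4, 5}"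
begin

definition var :: "nat \<Rightarrow> 5" where "var = inv_into UNIV ex"

abbreviation pow :: "nat \<Rightarrow> nat \<Rightarrow> (5 \<Rightarrow>\<^sub>0 nat)" where
  "pow k n \<equiv> Poly_Mapping.single (var k) n"

abbreviation f0 :: "'a::field poly ^ 5" where "f0 \<equiv> monomial_quintic ex"

lemma ex_var: "k \<in> {0, 1, 2, 4, 5} \<Longrightarrow> ex (var k) = k"
  using ex by (metis bij_betw_imp_surj_on f_inv_into_f var_def)

lemma ex_vars [simp]: "ex (var 0) = 0" "ex (var 1) = 1" "ex (var 2) = 2" "ex (var 4) = 4" "ex (var 5) = 5"
  by (simp_all add: ex_var)

lemma var_eq_iff: "k \<in> {0, 1, 2, 4, 5} \<Longrightarrow> l \<in> {0, 1, 2, 4, 5} \<Longrightarrow> var k = var l \<longleftrightarrow> k = l"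
  using ex_var by metis

text \<open>
  The monomials of \<open>F\<^sub>0\<close>. They form three pairs of equal weight, 17, 10 and 2, and opposite sign, so that \<open>F\<^sub>0\<close>
  vanishes at \<open>f\<^sub>0\<close>.
\<close>
definition quartic_exponents :: "nat \<Rightarrow> (5 \<Rightarrow>\<^sub>0 nat)" where
  "quartic_exponents r = [pow 4 3 + pow 5 1, pow 2 1 + pow 5 3, pow 1 1 + pow 2 2 + pow 5 1,
     pow 1 2 + pow 4 2, pow 0 3 + pow 2 1, pow 0 2 + pow 1 2] ! r"

definition quartic_sign :: "nat \<Rightarrow> 'a::field" where
  "quartic_sign r = [1, -1, 1, -1, 1, -1] ! r"

lemma lessThan_6: "{..<6::nat} = {0, 1, 2, 3, 4, 5}" by auto

lemma eval_pow: "eval_monom (($) (f0 :: 'a::field poly ^ 5)) (pow k n) = monom 1 (ex (var k) * n)"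
  by (simp add: eval_monom_single monomial_quintic_def monom_power)

lemma eval_quartic_exponents:
  assumes "r < 6"
  shows "eval_monom (($) (f0 :: 'a::field poly ^ 5)) (quartic_exponents r) = monom 1 ([17, 17, 10, 10, 2, 2] ! r)"
proof -
  have "r \<in> {0, 1, 2, 3, 4, 5}" using assms by auto
  then show ?thesis
    by (auto simp: quartic_exponents_def eval_monom_add eval_pow mult_monom)
qed

lemma sum_lookup_add:
  "(\<Sum>i\<in>UNIV. Poly_Mapping.lookup (m + n) i) =
     (\<Sum>i\<in>UNIV. Poly_Mapping.lookup m i) + (\<Sum>i\<in>UNIV. Poly_Mapping.lookup n i)"
  for m n :: "'v::finite \<Rightarrow>\<^sub>0 nat"
  by (simp add: lookup_add sum.distrib)

lemma sum_lookup_single: "(\<Sum>i\<in>UNIV. Poly_Mapping.lookup (Poly_Mapping.single (j::'v::finite) n) i) = n"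
  by (simp add: lookup_single when_def)

lemma degree_quartic_exponents:
  assumes "r < 6"
  shows "(\<Sum>i\<in>UNIV. Poly_Mapping.lookup (quartic_exponents r) i) = 4"
proof -
  have "r \<in> {0, 1, 2, 3, 4, 5}" using assms by auto
  then show ?thesis
    by (auto simp: quartic_exponents_def sum_lookup_add sum_lookup_single)
qed

text \<open>
  The gradient of \<open>F\<^sub>0\<close> at \<open>f\<^sub>0\<close>.
\<close>
definition gradient0 :: "'a::field poly ^ 5" where
  "gradient0 = (\<chi> i. \<Sum>r<6. smult (quartic_sign r) (eval_pderiv_monom i (($) f0) (quartic_exponents r)))"

lemma gradient0:
  fixes T defines "T \<equiv> \<lambda>k. monom (1::'a::field) k"
  shows "gradient0 $ var 0 = T 2"
    "gradient0 $ var 1 = - 2 * T 1 - T 9"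
    "gradient0 $ var 2 = T 0 + 2 * T 8 - T 15"
    "gradient0 $ var 4 = - 2 * T 6 + 3 * T 13"
    "gradient0 $ var 5 = T 5 - 2 * T 12"
proof -
  have pm: "eval_pderiv_monom (var k) (($) (f0 :: 'a poly ^ 5)) (quartic_exponents r) =
      (if k \<le> [17, 17, 10, 10, 2, 2] ! r
       then monom (of_nat (Poly_Mapping.lookup (quartic_exponents r) (var k))) ([17, 17, 10, 10, 2, 2] ! r - k) else 0)"
    if "r < 6" "k \<in> {0, 1, 2, 4, 5}" for r k
    by (rule eval_pderiv_monom_monomial_quintic[OF eval_quartic_exponents[OF that(1)] ex_var[OF that(2)]])
  have expand: "(gradient0 :: 'a poly ^ 5) $ var k = (\<Sum>r<6. smult (quartic_sign r) (if k \<le> [17, 17, 10, 10, 2, 2] ! r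
       then monom (of_nat (Poly_Mapping.lookup (quartic_exponents r) (var k))) ([17, 17, 10, 10, 2, 2] ! r - k) else 0))"
    if "k \<in> {0, 1, 2, 4, 5}" for k
    unfolding gradient0_def vec_lambda_beta using pm[OF _ that] by (intro sum.cong) auto
  note simps = expand lessThan_6 quartic_exponents_def quartic_sign_def lookup_add lookup_single when_def var_eq_iff
    smult_monom poly_eq_iff coeff_monom
  show "gradient0 $ var 0 = T 2"
    "gradient0 $ var 1 = - 2 * T 1 - T 9"
    "gradient0 $ var 2 = T 0 + 2 * T 8 - T 15"
    "gradient0 $ var 4 = - 2 * T 6 + 3 * T 13"
    "gradient0 $ var 5 = T 5 - 2 * T 12"
    by (simp_all add: simps T_def numeral_poly coeff_pCons split: nat.split)
qed

lemma gradient0_cubics: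
  assumes five: "(5::'a::field) \<noteq> 0" and k: "k \<le> 18"
  shows "\<exists>w. (\<forall>i. degree (w $ i) \<le> 3) \<and> dot gradient0 w = (monom 1 k :: 'a poly)"
proof -
  define S where "S = {dot (gradient0 :: 'a poly ^ 5) w | w. \<forall>i. degree (w $ i) \<le> 3}"
  define T where "T = (\<lambda>k. monom (1::'a) k)"
  have prod: "(gradient0 :: 'a poly ^ 5) $ i * T j \<in> S" if "j \<le> 3" for i j
  proof -
    have "degree ((axis i (T j) :: 'a poly ^ 5) $ l) \<le> 3" for l
      using that by (auto simp: axis_def T_def intro: order_trans[OF degree_monom_le])
    then show ?thesis unfolding S_def using dot_axis[of gradient0 i "T j", symmetric] by blast
  qed
  have TT: "T a * T b = T (a + b)" for a b by (simp add: T_def mult_monom)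
  have "T k \<in> S"
  proof (rule spanning_set_monomials[OF five _ _ T_def _ _ _ _ _ k])
    show "p + q \<in> S" if pq: "p \<in> S" "q \<in> S" for p q
    proof -
      obtain v w where "\<forall>i. degree (v $ i) \<le> 3" "\<forall>i. degree (w $ i) \<le> 3" "p = dot gradient0 v" "q = dot gradient0 w"
        using pq unfolding S_def by blast
      then have "p + q = dot gradient0 (v + w)" "\<forall>i. degree ((v + w) $ i) \<le> 3"
        by (simp_all add: dot_add degree_add_le)
      then show ?thesis unfolding S_def by blast
    qed
    show "smult c p \<in> S" if p: "p \<in> S" for c p
    proof -
      obtain v where "\<forall>i. degree (v $ i) \<le> 3" "p = dot gradient0 v"
        using p unfolding S_def by blast
      then have "smult c p = dot gradient0 ([:c:] *s v)" "\<forall>i. degree (([:c:] *s v) $ i) \<le> 3"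
        by (simp_all add: dot_scale order_trans[OF degree_smult_le])
      then show ?thesis unfolding S_def by blast
    qed
    fix j :: nat assume j: "j \<le> 3"
    note p = prod[OF j]
    show "T (2 + j) \<in> S" using p[of "var 0"] by (simp add: gradient0 TT flip: T_def)
    show "- 2 * T (1 + j) - T (9 + j) \<in> S"
      using p[of "var 1"] by (simp add: gradient0 left_diff_distrib mult.assoc TT flip: T_def)
    show "T j + 2 * T (8 + j) - T (15 + j) \<in> S"
      using p[of "var 2"] by (simp add: gradient0 left_diff_distrib distrib_right mult.assoc TT flip: T_def)
    show "- 2 * T (6 + j) + 3 * T (13 + j) \<in> S"
      using p[of "var 4"] by (simp add: gradient0 left_diff_distrib distrib_right mult.assoc TT flip: T_def)
    show "T (5 + j) - 2 * T (12 + j) \<in> S"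
      using p[of "var 5"] by (simp add: gradient0 left_diff_distrib distrib_right mult.assoc TT flip: T_def)
  qed
  then show ?thesis unfolding S_def T_def by auto
qed

lemma monomial_of_weight:
  assumes "k \<le> 20"
  shows "\<exists>m. (\<Sum>i\<in>UNIV. Poly_Mapping.lookup m i) = 4 \<and> eval_monom (($) (f0 :: 'a::field poly ^ 5)) m = monom 1 k"
proof -
  obtain a b c d where abcd: "{a, b, c, d} \<subseteq> {0, 1, 2, 4, 5}" "k = a + b + c + d"
    using four_parts[OF assms] by blast
  then have ev: "ex (var a) = a" "ex (var b) = b" "ex (var c) = c" "ex (var d) = d"
    by (simp_all only: insert_subset ex_var)
  show ?thesis
    by (rule exI[of _ "pow a 1 + pow b 1 + pow c 1 + pow d 1"])
      (simp add: sum_lookup_add sum_lookup_single eval_monom_add eval_pow ev mult_monom abcd(2))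
qed

end

section \<open>Deformation to the general quintic\<close>

lemma homogeneous_add: "homogeneous d P \<Longrightarrow> homogeneous d Q \<Longrightarrow> homogeneous d (P + Q)"
  using Poly_Mapping.keys_add[of P Q] by (auto simp: homogeneous_def)

lemma homogeneous_sum: "(\<And>r. r \<in> I \<Longrightarrow> homogeneous d (P r)) \<Longrightarrow> homogeneous d (\<Sum>r\<in>I. P r)"
  by (induction I rule: infinite_finite_induct) (auto intro: homogeneous_add simp: homogeneous_def[of d 0])

lemma homogeneous_single:
  "(\<Sum>i\<in>UNIV. Poly_Mapping.lookup m i) = d \<Longrightarrow> homogeneous d (Poly_Mapping.single m c)"
  by (auto simp: homogeneous_def)

lemma gradient_add: "gradient (P + Q) g = gradient P g + gradient Q g"
  by (simp add: gradient_def vec_eq_iff mpoly_pderiv_add mpoly_eval_add)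

lemma gradient_sum: "gradient (\<Sum>r\<in>I. P r) g = (\<Sum>r\<in>I. gradient (P r) g)"
  by (induction I rule: infinite_finite_induct)
    (simp_all add: gradient_add, simp_all add: gradient_def vec_eq_iff)

lemma gradient_single: "gradient (Poly_Mapping.single m c) g $ i = smult c (eval_pderiv_monom i (($) g) m)"
  by (cases "c = 0") (simp_all add: gradient_nth)

lemma polynomial_family_eval_pderiv_monom: "polynomial_family (\<lambda>f. eval_pderiv_monom i (($) f) m)"
  unfolding eval_pderiv_monom_def
  by (intro polynomial_family_mult polynomial_family_const polynomial_family_eval_monom)

lemma dot_sum: "dot G (\<Sum>r\<in>I. v r) = (\<Sum>r\<in>I. dot G (v r))"
  by (induction I rule: infinite_finite_induct) (simp_all add: dot_add)

context special_quintic begin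

text \<open>
  Two applications of \<open>open_basis_criterion\<close>. The first solves for the coefficients \<open>x k f\<close> that make
  \<open>D f F\<^sub>0 - \<Sum> x k f m\<^sub>k\<close> vanish along \<open>f\<close>, where \<open>m\<^sub>k\<close> is a quartic monomial of weight \<open>k\<close>; they vanish at
  \<open>f\<^sub>0\<close>, so this quartic specialises to \<open>F\<^sub>0\<close>. The second keeps the spanning condition:
  cubics that produce the monomials of degree at most 18 at \<open>f\<^sub>0\<close> still produce a basis near \<open>f\<^sub>0\<close>.
\<close>
lemma general_quartic:
  assumes five: "(5::'a::field) \<noteq> 0"
  obtains Q where "polynomial_function Q" "Q (f0 :: 'a poly ^ 5) \<noteq> 0"
    "\<And>f :: 'a poly ^ 5. f \<in> quintic_tuples \<Longrightarrow> smooth_rational_quintic f \<Longrightarrow> Q f \<noteq> 0 \<Longrightarrow>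
       \<exists>F. quartic_form F \<and> hypersurface_contains F f \<and> smooth_along F f \<and> balanced (normal_bundle F f)"
proof -
  let ?f0 = "f0 :: 'a poly ^ 5"
  have "\<forall>k. \<exists>m. k \<le> 20 \<longrightarrow> (\<Sum>i\<in>UNIV. Poly_Mapping.lookup m i) = 4 \<and> eval_monom (($) ?f0) m = monom 1 k"
    using monomial_of_weight by blast
  from choice[OF this] obtain \<nu> where "\<forall>k. k \<le> 20 \<longrightarrow>
      (\<Sum>i\<in>UNIV. Poly_Mapping.lookup (\<nu> k) i) = 4 \<and> eval_monom (($) ?f0) (\<nu> k) = monom 1 k" ..
  then have \<nu>: "\<And>k. k \<le> 20 \<Longrightarrow> (\<Sum>i\<in>UNIV. Poly_Mapping.lookup (\<nu> k) i) = 4"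
    "\<And>k. k \<le> 20 \<Longrightarrow> eval_monom (($) ?f0) (\<nu> k) = monom 1 k" by auto
  have "card (UNIV :: 21 set) = card {..20::nat}" by simp
  then obtain e :: "21 \<Rightarrow> nat" where e: "bij_betw e UNIV {..20}"
    using finite_same_card_bij[of "UNIV :: 21 set" "{..20::nat}"] by auto
  obtain D where D: "polynomial_function D" "D ?f0 = 1"
    and solve: "\<And>B. polynomial_family B \<Longrightarrow> \<exists>x. (\<forall>k\<le>20. polynomial_function (x k)) \<and>
       (\<forall>k\<le>20. x k ?f0 = coeff (B ?f0) k) \<and>
       (\<forall>f. D f \<noteq> 0 \<longrightarrow> degree (B f) \<le> 20 \<longrightarrow> (\<forall>k\<le>20. degree (eval_monom (($) f) (\<nu> k)) \<le> 20) \<longrightarrow>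
          (\<Sum>k\<le>20. smult (x k f) (eval_monom (($) f) (\<nu> k))) = smult (D f) (B f))"
    by (rule open_basis_criterion[OF e, of "\<lambda>k f. eval_monom (($) f) (\<nu> k)" ?f0])
      (use polynomial_family_eval_monom \<nu>(2) in auto)
  define B :: "'a poly ^ 5 \<Rightarrow> 'a poly" where
    "B f = (\<Sum>r<6. smult (quartic_sign r) (eval_monom (($) f) (quartic_exponents r)))" for f
  have "polynomial_family B"
    unfolding B_def[abs_def]
    by (intro polynomial_family_sum polynomial_family_smult polynomial_function_const polynomial_family_eval_monom)
  from solve[OF this] obtain x where x: "\<And>k. k \<le> 20 \<Longrightarrow> polynomial_function (x k)"
    "\<And>k. k \<le> 20 \<Longrightarrow> x k ?f0 = coeff (B ?f0) k"
    and sol: "\<And>f. D f \<noteq> 0 \<Longrightarrow> degree (B f) \<le> 20 \<Longrightarrow> (\<forall>k\<le>20. degree (eval_monom (($) f) (\<nu> k)) \<le> 20) \<Longrightarrow>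
          (\<Sum>k\<le>20. smult (x k f) (eval_monom (($) f) (\<nu> k))) = smult (D f) (B f)"
    by blast
  have B0: "B ?f0 = 0"
    unfolding B_def lessThan_6 by (simp add: eval_quartic_exponents quartic_sign_def)
  define F where "F f = (\<Sum>r<6. Poly_Mapping.single (quartic_exponents r) (D f * quartic_sign r))
     + (\<Sum>k\<le>20. Poly_Mapping.single (\<nu> k) (- x k f))" for f
  have homF: "homogeneous 4 (F f)" for f
    unfolding F_def by (intro homogeneous_add homogeneous_sum homogeneous_single)
      (simp_all add: degree_quartic_exponents \<nu>(1))
  have grad: "gradient (F f) g $ i = (\<Sum>r<6. smult (D f * quartic_sign r) (eval_pderiv_monom i (($) g) (quartic_exponents r)))
     + (\<Sum>k\<le>20. smult (- x k f) (eval_pderiv_monom i (($) g) (\<nu> k)))" for f g i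
    by (simp add: F_def gradient_add gradient_sum gradient_single)
  have grad0: "gradient (F ?f0) ?f0 = gradient0"
    by (simp add: vec_eq_iff grad gradient0_def D(2) x(2) B0)
  have Fzero: "mpoly_eval (\<lambda>c. [:c:]) (F f) (($) f) = 0" if f: "f \<in> quintic_tuples" and Df: "D f \<noteq> 0" for f
  proof -
    have "degree (B f) \<le> 20"
      unfolding B_def
    proof (intro degree_sum_le order_trans[OF degree_smult_le])
      fix r :: nat assume "r \<in> {..<6}"
      then show "degree (eval_monom (($) f) (quartic_exponents r)) \<le> 20"
        using degree_eval_monom_le[OF f, of "quartic_exponents r"] degree_quartic_exponents[of r] by simp
    qed simp
    moreover have "\<forall>k\<le>20. degree (eval_monom (($) f) (\<nu> k)) \<le> 20"
    proof (intro allI impI)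
      fix k :: nat assume "k \<le> 20"
      then show "degree (eval_monom (($) f) (\<nu> k)) \<le> 20"
        using degree_eval_monom_le[OF f, of "\<nu> k"] unfolding \<nu>(1)[OF \<open>k \<le> 20\<close>] by simp
    qed
    ultimately have "(\<Sum>k\<le>20. smult (x k f) (eval_monom (($) f) (\<nu> k))) = smult (D f) (B f)"
      by (rule sol[OF Df])
    moreover have "mpoly_eval (\<lambda>c. [:c:]) (F f) (($) f) =
        (\<Sum>r<6. smult (D f * quartic_sign r) (eval_monom (($) f) (quartic_exponents r)))
        + (\<Sum>k\<le>20. smult (- x k f) (eval_monom (($) f) (\<nu> k)))"
      by (simp add: F_def mpoly_eval_add mpoly_eval_sum mpoly_eval_single)
    ultimately show ?thesis
      by (simp add: B_def poly_space.scale_sum_right sum_negf)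
  qed
  have "\<forall>k. \<exists>w. k \<le> 18 \<longrightarrow> (\<forall>i. degree (w $ i) \<le> 3) \<and> dot gradient0 w = (monom 1 k :: 'a poly)"
    using gradient0_cubics[OF five] by blast
  from choice[OF this] obtain w where "\<forall>k. k \<le> 18 \<longrightarrow> (\<forall>i. degree (w k $ i) \<le> 3) \<and>
      dot gradient0 (w k) = (monom 1 k :: 'a poly)" ..
  then have w: "\<And>k i. k \<le> 18 \<Longrightarrow> degree (w k $ i) \<le> 3"
    "\<And>k. k \<le> 18 \<Longrightarrow> dot gradient0 (w k) = (monom 1 k :: 'a poly)" by auto
  define L where "L k f = dot (gradient (F f) f) (w k)" for k f
  have pF: "polynomial_family (\<lambda>f. gradient (F f) f $ i)" for i
    unfolding grad
    by (intro polynomial_family_add polynomial_family_sum polynomial_family_smult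
        polynomial_function_mult polynomial_function_uminus polynomial_function_const D(1) x(1)
        polynomial_family_eval_pderiv_monom) simp
  have pL: "polynomial_family (L k)" for k
    unfolding L_def[abs_def] dot_def
    by (intro polynomial_family_sum polynomial_family_mult pF polynomial_family_const)
  have L0: "L k ?f0 = monom 1 k" if "k \<le> 18" for k
    using w(2)[OF that] by (simp add: L_def grad0)
  have "card (UNIV :: 19 set) = card {..18::nat}" by simp
  then obtain e' :: "19 \<Rightarrow> nat" where e': "bij_betw e' UNIV {..18}"
    using finite_same_card_bij[of "UNIV :: 19 set" "{..18::nat}"] by auto
  obtain D' where D': "polynomial_function D'" "D' ?f0 = 1"
    and solve': "\<And>B. polynomial_family B \<Longrightarrow> \<exists>x. (\<forall>k\<le>18. polynomial_function (x k)) \<and>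
       (\<forall>k\<le>18. x k ?f0 = coeff (B ?f0) k) \<and>
       (\<forall>f. D' f \<noteq> 0 \<longrightarrow> degree (B f) \<le> 18 \<longrightarrow> (\<forall>k\<le>18. degree (L k f) \<le> 18) \<longrightarrow>
          (\<Sum>k\<le>18. smult (x k f) (L k f)) = smult (D' f) (B f))"
    by (rule open_basis_criterion[OF e', of L ?f0]) (use pL L0 in auto)
  show ?thesis
  proof (rule that[of "\<lambda>f. D f * D' f"])
    show "polynomial_function (\<lambda>f. D f * D' f)" by (intro polynomial_function_mult D(1) D'(1))
    show "D ?f0 * D' ?f0 \<noteq> 0" by (simp add: D(2) D'(2))
    fix f :: "'a poly ^ 5"
    assume f: "f \<in> quintic_tuples" and smooth: "smooth_rational_quintic f" and nz: "D f * D' f \<noteq> 0"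
    have cubics: "\<exists>v. (\<forall>i. degree (v $ i) \<le> 3) \<and> dot (gradient (F f) f) v = q" if q: "degree q \<le> 18" for q
    proof -
      have dL: "\<forall>k\<le>18. degree (L k f) \<le> 18"
        unfolding L_def using degree_dot_le[OF gradient_bounds(1)[OF f homF] w(1)] by force
      obtain y where "(\<Sum>k\<le>18. smult (y k f) (L k f)) = smult (D' f) q"
        using solve'[OF polynomial_family_const[of q]] nz q dL by auto
      then have "smult (inverse (D' f)) (\<Sum>k\<le>18. smult (y k f) (L k f)) = q"
        using nz by simp
      then have "dot (gradient (F f) f) (\<Sum>k\<le>18. [:inverse (D' f) * y k f:] *s w k) = q"
        by (simp add: dot_sum dot_scale L_def poly_space.scale_sum_right)
      moreover have "degree ((\<Sum>k\<le>18. [:inverse (D' f) * y k f:] *s w k) $ i) \<le> 3" for i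
        unfolding sum_component
        by (intro degree_sum_le) (auto intro!: order_trans[OF degree_smult_le] w(1))
      ultimately show ?thesis by blast
    qed
    have "quartic_form (F f) \<and> hypersurface_contains (F f) f \<and> smooth_along (F f) f \<and> balanced (normal_bundle (F f) f)"
      using nz by (intro quartic_with_spanning_gradient[OF five f smooth homF Fzero[OF f] cubics]) auto
    then show "\<exists>F. quartic_form F \<and> hypersurface_contains F f \<and> smooth_along F f \<and> balanced (normal_bundle F f)"
      by blast
  qed
qed

end

theorem proposition3p7:
  assumes "CHAR('a::alg_closed_field) \<noteq> 5"
  shows "for_general_rational_quintic (\<lambda>f :: 'a poly ^ 5.
           \<exists>F. quartic_form F \<and> hypersurface_contains F f \<and> smooth_along F f \<and>
               balanced (normal_bundle F f))"
proof -
  have five: "(5::'a) \<noteq> 0"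
  proof
    assume "(5::'a) = 0"
    then have "of_nat 5 = (0::'a)" by simp
    then have "CHAR('a) dvd 5" by (simp only: of_nat_eq_0_iff_char_dvd)
    moreover have "prime (5::nat)" by simp
    ultimately have "CHAR('a) = 1 \<or> CHAR('a) = 5" using prime_nat_iff by blast
    then show False using assms CHAR_not_1[where ?'a = 'a] by (simp add: One_nat_def)
  qed
  have "card (UNIV :: 5 set) = card {0, 1, 2, 4, 5::nat}" by simp
  then obtain ex :: "5 \<Rightarrow> nat" where ex: "bij_betw ex UNIV {0, 1, 2, 4, 5}"
    using finite_same_card_bij[of "UNIV :: 5 set" "{0, 1, 2, 4, 5::nat}"] by auto
  interpret special_quintic ex by unfold_locales (rule ex)
  let ?f0 = "f0 :: 'a poly ^ 5"
  obtain P where P: "polynomial_function P" "P ?f0 \<noteq> 0"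
    "\<And>f :: 'a poly ^ 5. f \<in> quintic_tuples \<Longrightarrow> P f \<noteq> 0 \<Longrightarrow> smooth_rational_quintic f"
    using general_quintic_smooth[OF ex] by blast
  obtain Q where Q: "polynomial_function Q" "Q ?f0 \<noteq> 0"
    "\<And>f :: 'a poly ^ 5. f \<in> quintic_tuples \<Longrightarrow> smooth_rational_quintic f \<Longrightarrow> Q f \<noteq> 0 \<Longrightarrow>
       \<exists>F. quartic_form F \<and> hypersurface_contains F f \<and> smooth_along F f \<and> balanced (normal_bundle F f)"
    using general_quartic[OF five] by blast
  define U where "U = {f \<in> quintic_tuples. P f * Q f \<noteq> 0}"
  obtain R :: "(5 \<times> nat, 'a) mpoly" where R: "\<And>f. mpoly_eval id R (\<lambda>(i, j). coeff (f $ i) j) = P f * Q f"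
    using polynomial_function_mult[OF P(1) Q(1)] unfolding polynomial_function_def by blast
  have "zariski_open U"
    unfolding zariski_open_def U_def by (rule exI[of _ "{R}"]) (simp add: R)
  moreover have "?f0 \<in> U"
  proof -
    have "ex i \<in> {0, 1, 2, 4, 5}" for i using bij_betwE[OF ex] by blast
    moreover have "\<forall>k\<in>{0, 1, 2, 4, 5::nat}. k \<le> 5" by simp
    ultimately have "ex i \<le> 5" for i by blast
    then show ?thesis
      using P(2) Q(2) by (auto simp: U_def quintic_tuples_def monomial_quintic_def
          intro: order_trans[OF degree_monom_le])
  qed
  ultimately show ?thesis
    unfolding for_general_rational_quintic_def using P(3) Q(3) by (auto simp: U_def intro!: exI[of _ U])
qed

end
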